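(* Let $\{\mathcal R(t)\}_{t\ge 0}$ be the resolvent family of the Volterra equation $X(t)=\int_0^t a(t-\tau)AX(\tau)\,d\tau+X_0+Z(t)$ and let $Z$ be an $H$-valued Lévy process. Fix $t>0$. For $n\in\mathbb N$ let $0=t_0<t_1<\dots<t_n=t$ be partitions of $[0,t]$ with mesh tending to $0$, choose points $s_i\in[t_{i-1},t_i]$, and put $\mathcal R_n:=\sum_{i=1}^n \mathcal R(s_i)\chi_{[t_{i-1},t_i]}$ (step functions on $[0,t]$). Then the integrals $\int_0^t \mathcal R_n(t-\tau)\,dZ(\tau)$ (defined as the corresponding finite sums of the form $\sum_k \Phi_n^k(Z(r_{k+1})-Z(r_k))$) converge in probability, the limit $$\int_0^t \mathcal R(t-\tau)\,dZ(\tau):=P\text{-}\lim_{n\to\infty}\int_0^t \mathcal R_n(t-\tau)\,dZ(\tau)$$ does not depend on the choice of the approximating sequence, and it is a well-defined $H$-valued random variable with an infinitely divisible distribution.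
   Context: $H$ is a real separable Hilbert space with inner product $\langle\cdot,\cdot\rangle_H$ and norm $|\cdot|_H$; $L(H)$ denotes bounded linear operators on $H$. $A$ is a closed linear operator in $H$ with dense domain $\mathcal D(A)$, and $a\in L^1_{\mathrm{loc}}(\mathbb R_+)$. The equation is assumed well-posed, with resolvent family $\{\mathcal R(t)\}_{t\ge0}\subset L(H)$: $\mathcal R(t)$ is uniformly bounded on compact intervals, strongly continuous in $t$, $\mathcal R(0)=I$, and the resolvent equation $\mathcal R(t)x=x+\int_0^t a(t-\tau)A\mathcal R(\tau)x\,d\tau$ holds for all $x\in\mathcal D(A)$, $t\ge0$. $(\Omega,\mathcal F,(\mathcal F_t),P)$ is a filtered probability space; an $H$-valued Lévy process $Z$ is an $(\mathcal F_t)$-adapted process with independent and stationary (homogeneous) increments, continuous in probability, with càdlàg paths and $Z(0)=0$. For a step function $\Phi=\sum_{k}\Phi^k\chi_{(r_k,r_{k+1}]}$ with $\Phi^k\in L(H)$, $\int\Phi\,dZ:=\sum_k\Phi^k(Z(r_{k+1})-Z(r_k))$. *)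

theory Defs
  imports "HOL-Probability.Probability"
begin

(* H is modelled by a type 'h of class real_inner + complete_space (Hilbert space),
  separability by second_countable_topology.  L(H) is the type 'h \<Rightarrow>\<^sub>L 'h. *)

definition closed_dense_operator :: "('h::real_inner) set \<Rightarrow> ('h \<Rightarrow> 'h) \<Rightarrow> bool" where
  "closed_dense_operator D A \<longleftrightarrow>
     subspace D \<and> closure D = UNIV \<and>
     (\<forall>x\<in>D. \<forall>y\<in>D. A (x + y) = A x + A y) \<and>
     (\<forall>c. \<forall>x\<in>D. A (c *\<^sub>R x) = c *\<^sub>R A x) \<and>
     closed {(x, A x) | x. x \<in> D}"

definition loc_integrable_Rplus :: "(real \<Rightarrow> real) \<Rightarrow> bool" where
  "loc_integrable_Rplus a \<longleftrightarrow> (\<forall>T\<ge>0. set_integrable lborel {0..T} a)"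

definition resolvent_family ::
  "('h::{real_inner,complete_space,second_countable_topology}) set \<Rightarrow> ('h \<Rightarrow> 'h) \<Rightarrow> (real \<Rightarrow> real)
     \<Rightarrow> (real \<Rightarrow> ('h \<Rightarrow>\<^sub>L 'h)) \<Rightarrow> bool" where
  "resolvent_family D A a R \<longleftrightarrow>
     (\<forall>T\<ge>0. \<exists>C. \<forall>t\<in>{0..T}. norm (R t) \<le> C) \<and>
     (\<forall>x. continuous_on {0..} (\<lambda>t. blinfun_apply (R t) x)) \<and>
     R 0 = id_blinfun \<and>
     (\<forall>x\<in>D. \<forall>t\<ge>0. \<forall>\<tau>\<in>{0..t}. blinfun_apply (R \<tau>) x \<in> D) \<and>
     (\<forall>x\<in>D. \<forall>t\<ge>0.
        has_bochner_integral (restrict_space lborel {0..t})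
          (\<lambda>\<tau>. a (t - \<tau>) *\<^sub>R A (blinfun_apply (R \<tau>) x))
          (blinfun_apply (R t) x - x))"

definition is_filtration :: "'a measure \<Rightarrow> (real \<Rightarrow> 'a measure) \<Rightarrow> bool" where
  "is_filtration M F \<longleftrightarrow>
     (\<forall>t. space (F t) = space M \<and> sets (F t) \<subseteq> sets M) \<and>
     (\<forall>s t. s \<le> t \<longrightarrow> sets (F s) \<subseteq> sets (F t))"

definition levy_process ::
  "'a measure \<Rightarrow> (real \<Rightarrow> 'a measure) \<Rightarrow> (real \<Rightarrow> 'a \<Rightarrow> 'h::{real_inner,complete_space,second_countable_topology}) \<Rightarrow> bool" where
  "levy_process M F Z \<longleftrightarrow>
     prob_space M \<and> is_filtration M F \<and>
     (\<forall>t\<ge>0. Z t \<in> borel_measurable (F t)) \<and>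
     (\<forall>(n::nat) (r::nat \<Rightarrow> real). 0 \<le> r 0 \<and> (\<forall>k<n. r k \<le> r (Suc k)) \<longrightarrow>
        prob_space.indep_vars M (\<lambda>_. borel) (\<lambda>k \<omega>. Z (r (Suc k)) \<omega> - Z (r k) \<omega>) {..<n}) \<and>
     (\<forall>s\<ge>0. \<forall>h\<ge>0. distr M borel (\<lambda>\<omega>. Z (s + h) \<omega> - Z s \<omega>) = distr M borel (\<lambda>\<omega>. Z h \<omega> - Z 0 \<omega>)) \<and>
     (\<forall>t\<ge>0. \<forall>e>0. ((\<lambda>s. measure M {\<omega>\<in>space M. e < dist (Z s \<omega>) (Z t \<omega>)}) \<longlongrightarrow> 0)
                        (at t within {0..})) \<and>
     (\<forall>\<omega>\<in>space M. \<forall>t\<ge>0. continuous (at_right t) (\<lambda>s. Z s \<omega>)) \<and>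
     (\<forall>\<omega>\<in>space M. \<forall>t>0. \<exists>l. ((\<lambda>s. Z s \<omega>) \<longlongrightarrow> l) (at_left t)) \<and>
     (\<forall>\<omega>\<in>space M. Z 0 \<omega> = 0)"

(* Integral of the step function Phi = sum_k Phi^k chi_(r_k, r_(k+1)] (k < K) against Z:
  sum_k Phi^k (Z(r_(k+1)) - Z(r_k)). *)
definition step_integral ::
  "(real \<Rightarrow> 'a \<Rightarrow> 'h::real_normed_vector) \<Rightarrow> (nat \<Rightarrow> ('h \<Rightarrow>\<^sub>L 'h)) \<Rightarrow> (nat \<Rightarrow> real) \<Rightarrow> nat \<Rightarrow> 'a \<Rightarrow> 'h" where
  "step_integral Z \<Phi> r K \<omega> = (\<Sum>k<K. blinfun_apply (\<Phi> k) (Z (r (Suc k)) \<omega> - Z (r k) \<omega>))"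

definition is_partition :: "real \<Rightarrow> nat \<Rightarrow> (nat \<Rightarrow> real) \<Rightarrow> bool" where
  "is_partition t N p \<longleftrightarrow> p 0 = 0 \<and> p N = t \<and> (\<forall>i<N. p i < p (Suc i))"

definition mesh :: "nat \<Rightarrow> (nat \<Rightarrow> real) \<Rightarrow> real" where
  "mesh N p = Max ((\<lambda>i. p (Suc i) - p i) ` {..<N})"

definition conv_in_prob :: "'a measure \<Rightarrow> (nat \<Rightarrow> 'a \<Rightarrow> 'b::metric_space) \<Rightarrow> ('a \<Rightarrow> 'b) \<Rightarrow> bool" where
  "conv_in_prob M X Y \<longleftrightarrow>
     (\<forall>e>0. (\<lambda>n. measure M {\<omega>\<in>space M. e < dist (X n \<omega>) (Y \<omega>)}) \<longlonglongrightarrow> 0)"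

definition infinitely_divisible :: "('h::{real_normed_vector,second_countable_topology}) measure \<Rightarrow> bool" where
  "infinitely_divisible \<mu> \<longleftrightarrow>
     prob_space \<mu> \<and> sets \<mu> = sets borel \<and>
     (\<forall>n::nat. n \<ge> 1 \<longrightarrow> (\<exists>\<nu>. prob_space \<nu> \<and> sets \<nu> = sets borel \<and>
        \<mu> = distr (PiM {..<n} (\<lambda>_. \<nu>)) borel (\<lambda>x. \<Sum>i<n. x i)))"

end

theory Submission
  imports Defs "HOL-Combinatorics.Transposition"
begin

text \<open>
  The key estimate concerns an exchangeable family \<open>\<xi>\<^sub>0, \<dots>, \<xi>\<^sub>N\<^sub>-\<^sub>1\<close> whose partial sums are all small in
  probability: then \<open>\<Sum> \<Phi>\<^sub>i \<xi>\<^sub>i\<close> is small in probability for all contractions \<open>\<Phi>\<^sub>i\<close>, uniformly in \<open>N\<close> and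
  without any moment assumption. Every signed sum \<open>\<Sum> \<plusminus>\<xi>\<^sub>i\<close> is small, so by the Paley--Zygmund
  inequality over the signs \<open>\<Sum> |\<xi>\<^sub>i|\<^sup>2\<close> is small. With the mean \<open>T\<close> of the \<open>\<Phi>\<^sub>i\<close>, the sum \<open>\<Sum> \<Phi>\<^sub>i \<xi>\<^sub>i\<close> is
  \<open>T (\<Sum> \<xi>\<^sub>i)\<close> plus \<open>\<Sum> (\<Phi>\<^sub>i - T) \<xi>\<^sub>i\<close>, and exchangeability bounds the second moment of the latter by
  the sum of squares.

  A Riemann sum is compared with the sum over a fine equidistant grid, where the increments of \<open>Z\<close> are
  exchangeable. The difference has coefficients \<open>R u - R v\<close> with \<open>u\<close> close to \<open>v\<close>. They are uniformly
  small on a finite-dimensional subspace, and on a suitable complement \<open>Z\<close> itself is uniformly small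
  in probability. Hence the Riemann sums are Cauchy in probability.

  For infinite divisibility, each grid increment is split into \<open>n\<close> parts. This writes the grid sum
  as a sum of \<open>n\<close> independent terms distributed like the grid sum for the process \<open>Z (u / n)\<close>, which
  converges in probability as well; the limit is taken on the \<open>n\<close>-fold product space.
\<close>

section \<open>Random signs\<close>

text \<open>Without moments there is no isometry for \<open>Z\<close>, and \<open>R\<close> is only
  strongly continuous, so \<open>R u - R v\<close> need not be small in operator norm however close
  u and v are. What is available is that sums of consecutive increments telescope to
  \<open>Z t - Z s\<close>. Exchangeability upgrades this to sums over arbitrary index sets, hence
  to all sign patterns. The mean of the coefficients is split off because the increments may share a
  drift: only coefficients that sum to zero cancel the correlations within the family. The
  increments over a general partition have different laws and are not exchangeable. For a fixed
  partition the points are therefore rounded down to a grid of \<open>L\<close> cells. As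
  \<open>L\<close> grows, stochastic continuity makes the rounding error vanish, while the estimate
  on the grid is uniform in \<open>L\<close>; the resulting bound is governed by the mesh
  alone.\<close>

definition signed_sum :: "nat set \<Rightarrow> nat \<Rightarrow> (nat \<Rightarrow> 'h::real_normed_vector) \<Rightarrow> 'h" where
  "signed_sum A n x = (\<Sum>i<n. if i \<in> A then x i else - x i)"

lemma signed_sum_0 [simp]: "signed_sum A 0 x = 0"
  by (simp add: signed_sum_def)

lemma signed_sum_Suc:
  assumes "A \<subseteq> {..<n}"
  shows "signed_sum A (Suc n) x = signed_sum A n x - x n"
    and "signed_sum (insert n A) (Suc n) x = signed_sum A n x + x n"
proof -
  have "n \<notin> A" using assms by auto
  then show "signed_sum A (Suc n) x = signed_sum A n x - x n"
    by (simp add: signed_sum_def)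
  have "(\<Sum>i<n. if i \<in> insert n A then x i else - x i) = (\<Sum>i<n. if i \<in> A then x i else - x i)"
    by (intro sum.cong) auto
  then show "signed_sum (insert n A) (Suc n) x = signed_sum A n x + x n"
    by (simp add: signed_sum_def)
qed

lemma sum_Pow_lessThan_Suc:
  fixes f :: "nat set \<Rightarrow> 'b::comm_monoid_add"
  shows "(\<Sum>A\<in>Pow {..<Suc n}. f A) = (\<Sum>A\<in>Pow {..<n}. f A + f (insert n A))"
proof -
  have inj: "inj_on (insert n) (Pow {..<n})"
    by (rule inj_onI) (metis Diff_insert_absorb PowD lessThan_iff less_irrefl subsetD insert_ident)
  have disj: "Pow {..<n} \<inter> insert n ` Pow {..<n} = {}" by auto
  show ?thesis
    unfolding lessThan_Suc Pow_insert
    using disj inj by (simp add: sum.union_disjoint sum.reindex sum.distrib)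
qed

text \<open>Sums over \<open>Pow {..<n}\<close> are 2^n times expectations over independent fair
  signs. The mixed inner products cancel between \<open>A\<close> and
  \<open>insert n A\<close>.\<close>

lemma sum_signed_sum_power2:
  fixes x :: "nat \<Rightarrow> 'h::real_inner"
  shows "(\<Sum>A\<in>Pow {..<n}. (norm (signed_sum A n x))\<^sup>2) = 2 ^ n * (\<Sum>i<n. (norm (x i))\<^sup>2)"
proof (induction n)
  case (Suc n)
  have "(\<Sum>A\<in>Pow {..<Suc n}. (norm (signed_sum A (Suc n) x))\<^sup>2)
      = (\<Sum>A\<in>Pow {..<n}. 2 * (norm (signed_sum A n x))\<^sup>2 + 2 * (norm (x n))\<^sup>2)"
    unfolding sum_Pow_lessThan_Suc
    by (intro sum.cong refl)
      (auto simp: signed_sum_Suc power2_norm_eq_inner inner_commute algebra_simps)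
  also have "\<dots> = 2 ^ Suc n * (\<Sum>i<Suc n. (norm (x i))\<^sup>2)"
    by (simp add: sum.distrib sum_distrib_left[symmetric] Suc card_Pow algebra_simps)
  finally show ?case .
qed simp

text \<open>With P = |a|^2 + |b|^2 the left side is 2 P^2 + 8 (a . b)^2. The coefficient 12 is 4
  from 2 P^2 plus 8 from Cauchy-Schwarz.\<close>

lemma norm_power4_parallelogram_le:
  fixes a b :: "'h::real_inner"
  shows "(norm (a - b)) ^ 4 + (norm (a + b)) ^ 4
    \<le> 2 * (norm a) ^ 4 + 12 * ((norm a)\<^sup>2 * (norm b)\<^sup>2) + 2 * (norm b) ^ 4"
proof -
  have p4: "norm z ^ 4 = (z \<bullet> z)\<^sup>2" for z :: 'h
    by (simp add: power2_norm_eq_inner[symmetric] flip: power_mult)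
  have "(a \<bullet> b)\<^sup>2 \<le> (a \<bullet> a) * (b \<bullet> b)" by (rule Cauchy_Schwarz_ineq)
  then show ?thesis
    unfolding p4 power2_norm_eq_inner
    by (simp add: inner_commute power2_eq_square algebra_simps)
qed

text \<open>Khinchin's inequality for the fourth moment. The induction step turns 3 Q^2 into 3 Q^2 +
  6 Q q + q^2, whose mixed term is exactly that of 3 (Q + q)^2, so the constant 3 reproduces
  itself.\<close>

lemma sum_signed_sum_power4:
  fixes x :: "nat \<Rightarrow> 'h::real_inner"
  shows "(\<Sum>A\<in>Pow {..<n}. (norm (signed_sum A n x)) ^ 4) \<le> 2 ^ n * (3 * (\<Sum>i<n. (norm (x i))\<^sup>2)\<^sup>2)"
proof (induction n)
  case (Suc n)
  let ?Q = "\<Sum>i<n. (norm (x i))\<^sup>2" and ?q = "(norm (x n))\<^sup>2"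
  have "(\<Sum>A\<in>Pow {..<Suc n}. (norm (signed_sum A (Suc n) x)) ^ 4)
      \<le> (\<Sum>A\<in>Pow {..<n}. 2 * (norm (signed_sum A n x)) ^ 4
            + 12 * ((norm (signed_sum A n x))\<^sup>2 * ?q) + 2 * (norm (x n)) ^ 4)"
    unfolding sum_Pow_lessThan_Suc
    by (intro sum_mono) (auto simp: signed_sum_Suc intro: norm_power4_parallelogram_le)
  also have "\<dots> = 2 * (\<Sum>A\<in>Pow {..<n}. (norm (signed_sum A n x)) ^ 4)
      + 12 * (2 ^ n * ?Q * ?q) + 2 ^ n * (2 * (norm (x n)) ^ 4)"
    by (simp add: sum.distrib sum_distrib_left[symmetric] sum_distrib_right[symmetric]
        sum_signed_sum_power2 card_Pow)
  also have "\<dots> \<le> 2 * (2 ^ n * (3 * ?Q\<^sup>2)) + 12 * (2 ^ n * ?Q * ?q) + 2 ^ n * (2 * ?q\<^sup>2)"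
    using Suc by (simp flip: power_mult)
  also have "\<dots> = 2 ^ Suc n * (3 * ?Q\<^sup>2 + 6 * (?Q * ?q) + ?q\<^sup>2)"
    by (simp add: algebra_simps)
  also have "\<dots> \<le> 2 ^ Suc n * (3 * (?Q + ?q)\<^sup>2)"
    by (intro mult_left_mono) (auto simp: power2_sum algebra_simps)
  finally show ?case by simp
qed simp

text \<open>Paley-Zygmund: over the signs, the squared norm X has mean Q and second moment at most 3
  Q^2, so X > Q / 2 has probability at least (1/2)^2 / 3 = 1/12.\<close>

lemma card_large_signed_sum:
  fixes x :: "nat \<Rightarrow> 'h::real_inner" and n :: nat
  defines "Q \<equiv> \<Sum>i<n. (norm (x i))\<^sup>2"
  assumes "Q > 0"
  shows "2 ^ n \<le> 12 * card {A \<in> Pow {..<n}. Q < 2 * (norm (signed_sum A n x))\<^sup>2 }"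
proof -
  define X where "X A = (norm (signed_sum A n x))\<^sup>2" for A
  define p where "p = (\<Sum>A\<in>Pow {..<n}. if Q < 2 * X A then 1 else 0 :: real)"
  \<comment> \<open>Young's inequality in place of Cauchy-Schwarz: X \<le> X^2 / (12 Q) + 3 Q on the
    large set, X \<le> Q / 2 off it. Averaging uses up at most Q / 2 + Q / 4 of the mean Q and
    leaves Q / 4 for 3 Q times the proportion of the large set. The weight 3 Q is the optimal
    one.\<close>
  have pt: "X A \<le> Q / 2 + ((X A)\<^sup>2 / (12 * Q) + 3 * Q * (if Q < 2 * X A then 1 else 0))" for A
  proof -
    have "0 \<le> (X A - 6 * Q)\<^sup>2" by simp
    then have "12 * Q * X A \<le> (X A)\<^sup>2 + 36 * Q\<^sup>2"
      by (simp add: power2_diff algebra_simps)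
    then have "X A \<le> ((X A)\<^sup>2 + 36 * Q\<^sup>2) / (12 * Q)"
      using \<open>Q > 0\<close> by (simp add: field_simps)
    also have "\<dots> = (X A)\<^sup>2 / (12 * Q) + 3 * Q"
      using \<open>Q > 0\<close> by (simp add: field_simps power2_eq_square)
    finally have le: "X A \<le> (X A)\<^sup>2 / (12 * Q) + 3 * Q" .
    have "0 \<le> (X A)\<^sup>2 / (12 * Q)" using \<open>Q > 0\<close> by simp
    then have "X A \<le> Q / 2 + (X A)\<^sup>2 / (12 * Q)" if "\<not> Q < 2 * X A"
      using that by linarith
    then show ?thesis using le \<open>Q > 0\<close> by auto
  qed
  have X4: "(\<Sum>A\<in>Pow {..<n}. (X A)\<^sup>2) \<le> 2 ^ n * (3 * Q\<^sup>2)"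
    using sum_signed_sum_power4[of n x] by (simp add: X_def Q_def flip: power_mult)
  have "2 ^ n * Q = (\<Sum>A\<in>Pow {..<n}. X A)"
    unfolding X_def Q_def by (simp add: sum_signed_sum_power2)
  also have "\<dots> \<le> (\<Sum>A\<in>Pow {..<n}. Q / 2 + ((X A)\<^sup>2 / (12 * Q) + 3 * Q * (if Q < 2 * X A then 1 else 0)))"
    by (intro sum_mono pt)
  also have "\<dots> = 2 ^ n * Q / 2 + (\<Sum>A\<in>Pow {..<n}. (X A)\<^sup>2) / (12 * Q) + 3 * Q * p"
    unfolding p_def sum.distrib sum_divide_distrib[symmetric] sum_distrib_left[symmetric]
    by (simp add: card_Pow)
  also have "\<dots> \<le> 2 ^ n * Q / 2 + 2 ^ n * (3 * Q\<^sup>2) / (12 * Q) + 3 * Q * p"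
    using X4 \<open>Q > 0\<close> by (intro add_mono divide_right_mono) auto
  also have "\<dots> = Q * (3 / 4 * 2 ^ n + 3 * p)"
    using \<open>Q > 0\<close> by (simp add: field_simps power2_eq_square)
  finally have "2 ^ n \<le> 12 * p"
    using \<open>Q > 0\<close> by (simp add: mult.commute[of _ Q])
  moreover have "p = real (card {A \<in> Pow {..<n}. Q < 2 * X A})"
    unfolding p_def by (simp add: sum.If_cases Int_def)
  ultimately have "real (2 ^ n) \<le> real (12 * card {A \<in> Pow {..<n}. Q < 2 * X A})"
    by simp
  then show ?thesis unfolding X_def by (simp only: of_nat_le_iff)
qed

section \<open>Exchangeable families\<close>

text \<open>Injections instead of permutations of \<open>{..<N}\<close>: any m distinct members have
  the joint law of the first m, so subfamilies need no separate passage to marginals.\<close>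

definition exchangeable :: "'a measure \<Rightarrow> nat \<Rightarrow> (nat \<Rightarrow> 'a \<Rightarrow> 'h::{real_normed_vector,second_countable_topology}) \<Rightarrow> bool" where
  "exchangeable M N \<xi> \<longleftrightarrow>
     (\<forall>i<N. \<xi> i \<in> borel_measurable M) \<and>
     (\<forall>m f. inj_on f {..<m} \<and> f ` {..<m} \<subseteq> {..<N} \<longrightarrow>
        distr M (PiM {..<m} (\<lambda>_. borel)) (\<lambda>\<omega>. \<lambda>i\<in>{..<m}. \<xi> (f i) \<omega>) =
        distr M (PiM {..<m} (\<lambda>_. borel)) (\<lambda>\<omega>. \<lambda>i\<in>{..<m}. \<xi> i \<omega>))"

lemma exchangeable_measurable:
  "exchangeable M N \<xi> \<Longrightarrow> i < N \<Longrightarrow> \<xi> i \<in> borel_measurable M"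
  by (simp add: exchangeable_def)

lemma exchangeable_distr:
  fixes \<xi> :: "nat \<Rightarrow> 'a \<Rightarrow> 'h::{real_normed_vector,second_countable_topology}"
  assumes ex: "exchangeable M N \<xi>" and f: "inj_on f {..<m}" "f ` {..<m} \<subseteq> {..<N}"
    and g: "g \<in> measurable (PiM {..<m} (\<lambda>_. borel)) K"
  shows "distr M K (\<lambda>\<omega>. g (\<lambda>i\<in>{..<m}. \<xi> (f i) \<omega>)) = distr M K (\<lambda>\<omega>. g (\<lambda>i\<in>{..<m}. \<xi> i \<omega>))"
proof -
  have mN: "m \<le> N"
    using card_mono[OF finite_lessThan f(2)] by (simp add: card_image f(1))
  have m1: "(\<lambda>\<omega>. \<lambda>i\<in>{..<m}. \<xi> (f i) \<omega>) \<in> measurable M (PiM {..<m} (\<lambda>_. borel))"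
    using f(2) by (intro measurable_restrict exchangeable_measurable[OF ex]) auto
  have m2: "(\<lambda>\<omega>. \<lambda>i\<in>{..<m}. \<xi> i \<omega>) \<in> measurable M (PiM {..<m} (\<lambda>_. borel))"
    using mN by (intro measurable_restrict exchangeable_measurable[OF ex]) auto
  have "distr M (PiM {..<m} (\<lambda>_. borel)) (\<lambda>\<omega>. \<lambda>i\<in>{..<m}. \<xi> (f i) \<omega>) =
        distr M (PiM {..<m} (\<lambda>_. borel)) (\<lambda>\<omega>. \<lambda>i\<in>{..<m}. \<xi> i \<omega>)"
    using ex f unfolding exchangeable_def by blast
  then have "distr (distr M (PiM {..<m} (\<lambda>_. borel)) (\<lambda>\<omega>. \<lambda>i\<in>{..<m}. \<xi> (f i) \<omega>)) K g =
        distr (distr M (PiM {..<m} (\<lambda>_. borel)) (\<lambda>\<omega>. \<lambda>i\<in>{..<m}. \<xi> i \<omega>)) K g"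
    by simp
  then show ?thesis
    by (simp add: distr_distr[OF g m1] distr_distr[OF g m2] comp_def)
qed

lemma exchangeable_compose:
  fixes \<xi> :: "nat \<Rightarrow> 'a \<Rightarrow> 'h::{real_normed_vector,second_countable_topology}"
    and g :: "'h \<Rightarrow> 'h"
  assumes ex: "exchangeable M N \<xi>" and [measurable]: "g \<in> borel_measurable borel"
  shows "exchangeable M N (\<lambda>i \<omega>. g (\<xi> i \<omega>))"
  unfolding exchangeable_def
proof (intro conjI allI impI)
  show "(\<lambda>\<omega>. g (\<xi> i \<omega>)) \<in> borel_measurable M" if "i < N" for i
    using exchangeable_measurable[OF ex that] by measurable
next
  fix m :: nat and f assume f: "inj_on f {..<m} \<and> f ` {..<m} \<subseteq> {..<N}"
  have "(\<lambda>x. \<lambda>i\<in>{..<m}. g (x i)) \<in> measurable (PiM {..<m} (\<lambda>_. borel)) (PiM {..<m} (\<lambda>_. borel))"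
    by measurable
  from exchangeable_distr[OF ex conjunct1[OF f] conjunct2[OF f] this]
  show "distr M (PiM {..<m} (\<lambda>_. borel)) (\<lambda>\<omega>. \<lambda>i\<in>{..<m}. g (\<xi> (f i) \<omega>)) =
        distr M (PiM {..<m} (\<lambda>_. borel)) (\<lambda>\<omega>. \<lambda>i\<in>{..<m}. g (\<xi> i \<omega>))"
    by (simp cong: restrict_cong)
qed

lemma exchangeable_expectation:
  fixes \<xi> :: "nat \<Rightarrow> 'a \<Rightarrow> 'h::{real_normed_vector,second_countable_topology}" and g :: "_ \<Rightarrow> real"
  assumes ex: "exchangeable M N \<xi>" and f: "inj_on f {..<m}" "f ` {..<m} \<subseteq> {..<N}"
    and g: "g \<in> borel_measurable (PiM {..<m} (\<lambda>_. borel))"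
  shows "(\<integral>\<omega>. g (\<lambda>i\<in>{..<m}. \<xi> (f i) \<omega>) \<partial>M) = (\<integral>\<omega>. g (\<lambda>i\<in>{..<m}. \<xi> i \<omega>) \<partial>M)"
proof -
  have mN: "m \<le> N"
    using card_mono[OF finite_lessThan f(2)] by (simp add: card_image f(1))
  have m1: "(\<lambda>\<omega>. g (\<lambda>i\<in>{..<m}. \<xi> (f i) \<omega>)) \<in> borel_measurable M"
    using f(2) by (intro measurable_compose[OF _ g] measurable_restrict exchangeable_measurable[OF ex]) auto
  have m2: "(\<lambda>\<omega>. g (\<lambda>i\<in>{..<m}. \<xi> i \<omega>)) \<in> borel_measurable M"
    using mN by (intro measurable_compose[OF _ g] measurable_restrict exchangeable_measurable[OF ex]) auto
  show ?thesis
    using exchangeable_distr[OF ex f g] integral_distr[OF m1, of "\<lambda>x. x"] integral_distr[OF m2, of "\<lambda>x. x"]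
    by simp
qed

text \<open>The law of a sum depends only on its number of terms. Partial sums telescope in the
  application, so sums over scattered indices inherit their bounds.\<close>

lemma exchangeable_prob_sum:
  assumes ex: "exchangeable M N \<xi>" and A: "A \<subseteq> {..<N}"
  shows "measure M {\<omega>\<in>space M. e < norm (\<Sum>i\<in>A. \<xi> i \<omega>)}
    = measure M {\<omega>\<in>space M. e < norm (\<Sum>i<card A. \<xi> i \<omega>)}"
proof -
  have finA: "finite A" using A finite_subset by blast
  obtain f where f: "bij_betw f {..<card A} A"
    using ex_bij_betw_nat_finite[OF finA] by (auto simp: atLeast0LessThan)
  have inj: "inj_on f {..<card A}" and im: "f ` {..<card A} \<subseteq> {..<N}"
    using f A by (auto simp: bij_betw_def)
  have cN: "card A \<le> N" using card_mono[OF _ A] by simp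
  define g where "g x = norm (\<Sum>i<card A. x i)" for x :: "nat \<Rightarrow> 'b"
  have g: "g \<in> borel_measurable (PiM {..<card A} (\<lambda>_. borel))"
    unfolding g_def by measurable
  have g1: "g (\<lambda>i\<in>{..<card A}. \<xi> (f i) \<omega>) = norm (\<Sum>i\<in>A. \<xi> i \<omega>)" for \<omega>
    unfolding g_def using sum.reindex_bij_betw[OF f, of "\<lambda>i. \<xi> i \<omega>"] by simp
  have g2: "g (\<lambda>i\<in>{..<card A}. \<xi> i \<omega>) = norm (\<Sum>i<card A. \<xi> i \<omega>)" for \<omega>
    unfolding g_def by simp
  have eq: "distr M borel (\<lambda>\<omega>. norm (\<Sum>i\<in>A. \<xi> i \<omega>)) = distr M borel (\<lambda>\<omega>. norm (\<Sum>i<card A. \<xi> i \<omega>))"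
    using exchangeable_distr[OF ex inj im g] unfolding g1 g2 .
  have m1: "(\<lambda>\<omega>. norm (\<Sum>i\<in>A. \<xi> i \<omega>)) \<in> borel_measurable M"
    using A by (intro measurable_compose[OF _ borel_measurable_norm] borel_measurable_sum exchangeable_measurable[OF ex]) auto
  have m2: "(\<lambda>\<omega>. norm (\<Sum>i<card A. \<xi> i \<omega>)) \<in> borel_measurable M"
    using cN by (intro measurable_compose[OF _ borel_measurable_norm] borel_measurable_sum exchangeable_measurable[OF ex]) auto
  show ?thesis
    using arg_cong[OF eq, of "\<lambda>D. measure D {e<..}"]
    by (simp add: measure_distr[OF m1] measure_distr[OF m2] vimage_def Int_def conj_commute)
qed

text \<open>For every choice of signs, the signed sum of an exchangeable family is a difference of two
  sums distributed like partial sums; averaging over the signs turns this into a bound for the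
  sum of squares.\<close>

lemma (in prob_space) exchangeable_sum_squares:
  fixes \<xi> :: "nat \<Rightarrow> 'a \<Rightarrow> 'h::{real_inner,second_countable_topology}"
  assumes ex: "exchangeable M N \<xi>" and "\<eta> > 0"
    and small: "\<And>k. k \<le> N \<Longrightarrow> prob {\<omega>\<in>space M. \<eta> < norm (\<Sum>i<k. \<xi> i \<omega>)} \<le> \<eta>"
  shows "prob {\<omega>\<in>space M. 8 * \<eta>\<^sup>2 < (\<Sum>i<N. (norm (\<xi> i \<omega>))\<^sup>2)} \<le> 24 * \<eta>"
proof -
  have [measurable]: "i < N \<Longrightarrow> \<xi> i \<in> borel_measurable M" for i
    using exchangeable_measurable[OF ex] .
  define E where "E = {\<omega>\<in>space M. 8 * \<eta>\<^sup>2 < (\<Sum>i<N. (norm (\<xi> i \<omega>))\<^sup>2)}"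
  \<comment> \<open>The threshold 2 \<eta> allows one \<eta> for the terms with sign plus and one
    for those with sign minus, whence the bound 2 \<eta> for \<open>prob (B A)\<close>.\<close>
  define B where "B A = {\<omega>\<in>space M. 2 * \<eta> < norm (signed_sum A N (\<lambda>i. \<xi> i \<omega>))}" for A
  have E [measurable]: "E \<in> sets M" unfolding E_def by measurable
  have B [measurable]: "B A \<in> sets M" for A
    unfolding B_def signed_sum_def by measurable
  have PB: "prob (B A) \<le> 2 * \<eta>" if A: "A \<subseteq> {..<N}" for A
  proof -
    let ?U = "\<lambda>A. {\<omega>\<in>space M. \<eta> < norm (\<Sum>i\<in>A. \<xi> i \<omega>)}"
    have U: "?U C \<in> sets M" "prob (?U C) \<le> \<eta>" if C: "C \<subseteq> {..<N}" for C
    proof -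
      have "i \<in> C \<Longrightarrow> \<xi> i \<in> borel_measurable M" for i using C by auto
      then have [measurable]: "(\<lambda>\<omega>. \<Sum>i\<in>C. \<xi> i \<omega>) \<in> borel_measurable M"
        by (rule borel_measurable_sum)
      show "?U C \<in> sets M" by measurable
      show "prob (?U C) \<le> \<eta>"
        unfolding exchangeable_prob_sum[OF ex C]
        using small card_mono[OF _ C] by simp
    qed
    have "B A \<subseteq> ?U A \<union> ?U ({..<N} - A)"
    proof
      fix \<omega> assume w: "\<omega> \<in> B A"
      have "signed_sum A N (\<lambda>i. \<xi> i \<omega>) = (\<Sum>i\<in>A. \<xi> i \<omega>) - (\<Sum>i\<in>{..<N} - A. \<xi> i \<omega>)"
        unfolding signed_sum_def using A
        by (simp add: sum.If_cases Int_absorb1 sum_negf Diff_eq)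
      then have "norm (signed_sum A N (\<lambda>i. \<xi> i \<omega>))
          \<le> norm (\<Sum>i\<in>A. \<xi> i \<omega>) + norm (\<Sum>i\<in>{..<N} - A. \<xi> i \<omega>)"
        by (simp add: norm_triangle_ineq4)
      then show "\<omega> \<in> ?U A \<union> ?U ({..<N} - A)" using w unfolding B_def by auto
    qed
    then have "prob (B A) \<le> prob (?U A \<union> ?U ({..<N} - A))"
      using U A by (intro finite_measure_mono) auto
    also have "\<dots> \<le> prob (?U A) + prob (?U ({..<N} - A))"
      using U A by (intro measure_Un_le) auto
    also have "\<dots> \<le> 2 * \<eta>" using U(2)[OF A] U(2)[of "{..<N} - A"] by simp
    finally show ?thesis .
  qed
  \<comment> \<open>On \<open>E\<close> at least 1/12 of the sign patterns have squared norm above Q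
    / 2, and Q / 2 > 4 \<eta>^2 = (2 \<eta>)^2; hence the level 8 \<eta>^2. Integrating gives the
    factor 24 as 12 times 2.\<close>
  have pt: "2 ^ N * indicator E \<omega> \<le> 12 * (\<Sum>A\<in>Pow {..<N}. indicator (B A) \<omega> :: real)" if "\<omega> \<in> space M" for \<omega>
  proof (cases "\<omega> \<in> E")
    case True
    define Q where "Q = (\<Sum>i<N. (norm (\<xi> i \<omega>))\<^sup>2)"
    have Q: "8 * \<eta>\<^sup>2 < Q" using True by (simp add: E_def Q_def)
    then have "Q > 0" using \<open>\<eta> > 0\<close> by (smt (verit) zero_le_power2)
    then have "2 ^ N \<le> 12 * card {A \<in> Pow {..<N}. Q < 2 * (norm (signed_sum A N (\<lambda>i. \<xi> i \<omega>)))\<^sup>2}"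
      unfolding Q_def by (rule card_large_signed_sum)
    also have "\<dots> \<le> 12 * card {A \<in> Pow {..<N}. \<omega> \<in> B A}"
    proof (intro mult_le_mono2 card_mono)
      show "{A \<in> Pow {..<N}. Q < 2 * (norm (signed_sum A N (\<lambda>i. \<xi> i \<omega>)))\<^sup>2} \<subseteq> {A \<in> Pow {..<N}. \<omega> \<in> B A}"
      proof safe
        fix A assume "Q < 2 * (norm (signed_sum A N (\<lambda>i. \<xi> i \<omega>)))\<^sup>2"
        then have "(2 * \<eta>)\<^sup>2 < (norm (signed_sum A N (\<lambda>i. \<xi> i \<omega>)))\<^sup>2"
          using Q by (simp add: power_mult_distrib)
        then show "\<omega> \<in> B A" unfolding B_def using that by (auto intro: power2_less_imp_less)
      qed
    qed auto
    finally have "real (2 ^ N) \<le> real (12 * card {A \<in> Pow {..<N}. \<omega> \<in> B A})"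
      by (simp only: of_nat_le_iff)
    moreover have "(\<Sum>A\<in>Pow {..<N}. indicator (B A) \<omega> :: real) = card {A \<in> Pow {..<N}. \<omega> \<in> B A}"
      unfolding indicator_def by (simp add: sum.If_cases Int_def)
    ultimately show ?thesis using True by simp
  qed (auto intro: sum_nonneg)
  have "2 ^ N * prob E = expectation (\<lambda>\<omega>. 2 ^ N * indicator E \<omega>)"
    by simp
  also have "\<dots> \<le> expectation (\<lambda>\<omega>. 12 * (\<Sum>A\<in>Pow {..<N}. indicator (B A) \<omega> :: real))"
    by (intro integral_mono pt) (auto intro!: integrable_mult_right integrable_sum integrable_real_indicator simp: less_top[symmetric])
  also have "\<dots> = 12 * (\<Sum>A\<in>Pow {..<N}. prob (B A))"
    by (subst integral_mult_right_zero, subst Bochner_Integration.integral_sum)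
      (auto intro!: integrable_real_indicator simp: less_top[symmetric])
  also have "\<dots> \<le> 12 * (\<Sum>A\<in>Pow {..<N}. 2 * \<eta>)"
    by (intro mult_left_mono sum_mono PB) auto
  also have "\<dots> = 2 ^ N * (24 * \<eta>)" by (simp add: card_Pow)
  finally show ?thesis unfolding E_def by simp
qed

text \<open>In \<open>exchangeable_second_moment\<close> each truncated vector \<open>y i\<close>
  depends on the whole family, so moving a pair (i, j) to (0, 1) takes a permutation of all indices,
  not merely an injection of two.\<close>

lemma ex_bij_betw_lessThan_two_values:
  assumes "i < N" "j < N" "i \<noteq> j"
  obtains f where "bij_betw f {..<N} {..<N}" "f 0 = i" "f (Suc 0) = j"
proof
  have N: "0 < N" "Suc 0 < N" using assms by auto
  \<comment> \<open>\<open>?k\<close> is the preimage of j under the outer transposition. It is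
    nonzero because i and j differ, so the inner transposition fixes 0.\<close>
  let ?k = "Transposition.transpose 0 i j"
  let ?f = "Transposition.transpose 0 i \<circ> Transposition.transpose (Suc 0) ?k"
  have k: "?k < N" "?k \<noteq> 0" using assms N by (auto simp: Transposition.transpose_def)
  have b: "bij_betw (Transposition.transpose a b) {..<N} {..<N}" if "a < N" "b < N" for a b
    using that by (intro bij_betw_byWitness[where f' = "Transposition.transpose a b"]) (auto simp: Transposition.transpose_def)
  show "bij_betw ?f {..<N} {..<N}"
    by (rule bij_betw_trans[OF b b]) (use N k assms in auto)
  show "?f 0 = i" using k by (auto simp: Transposition.transpose_def)
  show "?f (Suc 0) = j" by simp
qed

text \<open>Truncation supplies the moments, and its event is symmetric in the indices, so all pairs
  \<open>y i\<close>, \<open>y j\<close> with i \<noteq> j have one joint law. If every pair is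
  replaced by \<open>y 0\<close>, \<open>y (Suc 0)\<close>, the double sum vanishes by centring, so
  the off-diagonal part is minus a diagonal. The true diagonal and this one contribute at most 4 N v
  each, and N v \<le> \<kappa>.\<close>

lemma (in prob_space) exchangeable_second_moment:
  fixes \<xi> :: "nat \<Rightarrow> 'a \<Rightarrow> 'h::{real_inner,second_countable_topology}"
    and \<Psi> :: "nat \<Rightarrow> 'h \<Rightarrow> 'h"
  assumes ex: "exchangeable M N \<xi>" and "\<kappa> \<ge> 0"
    and lin: "\<And>i. i < N \<Longrightarrow> bounded_linear (\<Psi> i)"
    and bound: "\<And>i x. i < N \<Longrightarrow> norm (\<Psi> i x) \<le> 2 * norm x"
    and centred: "\<And>x. (\<Sum>i<N. \<Psi> i x) = 0"
  defines "y \<equiv> \<lambda>i \<omega>. if (\<Sum>k<N. (norm (\<xi> k \<omega>))\<^sup>2) \<le> \<kappa> then \<xi> i \<omega> else 0"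
  shows "integrable M (\<lambda>\<omega>. (norm (\<Sum>i<N. \<Psi> i (y i \<omega>)))\<^sup>2)"
    and "expectation (\<lambda>\<omega>. (norm (\<Sum>i<N. \<Psi> i (y i \<omega>)))\<^sup>2) \<le> 8 * \<kappa>"
proof -
  have mx [measurable]: "i < N \<Longrightarrow> \<xi> i \<in> borel_measurable M" for i
    using exchangeable_measurable[OF ex] .
  have my [measurable]: "i < N \<Longrightarrow> y i \<in> borel_measurable M" for i
    unfolding y_def by measurable
  have m\<Psi> [measurable]: "i < N \<Longrightarrow> \<Psi> i \<in> borel_measurable borel" for i
    using lin by (intro borel_measurable_continuous_onI linear_continuous_on)
  have sumy: "(\<Sum>i<N. (norm (y i \<omega>))\<^sup>2) \<le> \<kappa>" for \<omega>
    using \<open>\<kappa> \<ge> 0\<close> by (cases "(\<Sum>k<N. (norm (\<xi> k \<omega>))\<^sup>2) \<le> \<kappa>") (simp_all add: y_def)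
  have y2: "(norm (y i \<omega>))\<^sup>2 \<le> \<kappa>" if "i < N" for i \<omega>
    using member_le_sum[of i "{..<N}" "\<lambda>i. (norm (y i \<omega>))\<^sup>2"] sumy[of \<omega>] that by simp
  have yb: "norm (y i \<omega>) \<le> sqrt \<kappa>" if "i < N" for i \<omega>
    using y2[OF that] by (simp add: real_le_rsqrt)
  have inner_bound: "\<bar>\<Psi> i u \<bullet> \<Psi> j v\<bar> \<le> 4 * (norm u * norm v)" if "i < N" "j < N" for i j u v
  proof -
    have "\<bar>\<Psi> i u \<bullet> \<Psi> j v\<bar> \<le> norm (\<Psi> i u) * norm (\<Psi> j v)"
      by (rule Cauchy_Schwarz_ineq2)
    also have "\<dots> \<le> (2 * norm u) * (2 * norm v)"
      using bound that by (intro mult_mono) auto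
    finally show ?thesis by simp
  qed
  have int: "integrable M (\<lambda>\<omega>. \<Psi> i (y k \<omega>) \<bullet> \<Psi> j (y l \<omega>))"
    if "i < N" "j < N" "k < N" "l < N" for i j k l
  proof (rule integrable_const_bound[where B = "4 * (sqrt \<kappa> * sqrt \<kappa>)"])
    have "\<bar>\<Psi> i (y k \<omega>) \<bullet> \<Psi> j (y l \<omega>)\<bar> \<le> 4 * (sqrt \<kappa> * sqrt \<kappa>)" for \<omega>
    proof -
      have "norm (y k \<omega>) * norm (y l \<omega>) \<le> sqrt \<kappa> * sqrt \<kappa>"
        using yb that \<open>\<kappa> \<ge> 0\<close> by (intro mult_mono) auto
      then show ?thesis using inner_bound[of i j "y k \<omega>" "y l \<omega>"] that by linarith
    qed
    then show "AE \<omega> in M. norm (\<Psi> i (y k \<omega>) \<bullet> \<Psi> j (y l \<omega>)) \<le> 4 * (sqrt \<kappa> * sqrt \<kappa>)"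
      by simp
    show "(\<lambda>\<omega>. \<Psi> i (y k \<omega>) \<bullet> \<Psi> j (y l \<omega>)) \<in> borel_measurable M"
      using that by measurable
  qed
  have inty: "integrable M (\<lambda>\<omega>. (norm (y i \<omega>))\<^sup>2)" if "i < N" for i
    by (rule integrable_const_bound[where B = \<kappa>]) (use y2 that in \<open>auto\<close>)
  have sq: "(norm (\<Sum>i<N. \<Psi> i (y i \<omega>)))\<^sup>2 = (\<Sum>i<N. \<Sum>j<N. \<Psi> i (y i \<omega>) \<bullet> \<Psi> j (y j \<omega>))" for \<omega>
    unfolding power2_norm_eq_inner inner_sum_right by (simp add: inner_sum_left) (rule sum.swap)
  have dsum: "expectation (\<lambda>\<omega>. \<Sum>i<N. \<Sum>j<N. H i j \<omega>) = (\<Sum>i<N. \<Sum>j<N. expectation (H i j))"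
    if "\<And>i j. i < N \<Longrightarrow> j < N \<Longrightarrow> integrable M (H i j)" for H :: "nat \<Rightarrow> nat \<Rightarrow> 'a \<Rightarrow> real"
  proof -
    have "expectation (\<lambda>\<omega>. \<Sum>i<N. \<Sum>j<N. H i j \<omega>) = (\<Sum>i<N. expectation (\<lambda>\<omega>. \<Sum>j<N. H i j \<omega>))"
      by (intro Bochner_Integration.integral_sum Bochner_Integration.integrable_sum that) auto
    also have "\<dots> = (\<Sum>i<N. \<Sum>j<N. expectation (H i j))"
      by (intro sum.cong refl Bochner_Integration.integral_sum that) auto
    finally show ?thesis .
  qed
  show "integrable M (\<lambda>\<omega>. (norm (\<Sum>i<N. \<Psi> i (y i \<omega>)))\<^sup>2)"
    unfolding sq by (intro Bochner_Integration.integrable_sum int) auto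
  show "expectation (\<lambda>\<omega>. (norm (\<Sum>i<N. \<Psi> i (y i \<omega>)))\<^sup>2) \<le> 8 * \<kappa>"
  proof (cases "N < 2")
    case True
    \<comment> \<open>For N = 1 centring says that \<open>\<Psi> 0\<close> vanishes. The general
      argument needs two distinct indices.\<close>
    then consider "N = 0" | "N = 1" by linarith
    then show ?thesis
      using \<open>\<kappa> \<ge> 0\<close> centred by cases auto
  next
    case False
    then have N: "0 < N" "Suc 0 < N" by auto
    have exch: "expectation (\<lambda>\<omega>. h (y i \<omega>) (y j \<omega>)) = expectation (\<lambda>\<omega>. h (y 0 \<omega>) (y (Suc 0) \<omega>))"
      if ij: "i < N" "j < N" "i \<noteq> j"
        and [measurable]: "(\<lambda>(u, v). h u v) \<in> borel_measurable (borel \<Otimes>\<^sub>M borel)"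
      for i j and h :: "'h \<Rightarrow> 'h \<Rightarrow> real"
    proof -
      obtain f where f: "bij_betw f {..<N} {..<N}" and f01: "f 0 = i" "f (Suc 0) = j"
        using ex_bij_betw_lessThan_two_values[OF ij] .
      define Y where "Y x k = (if (\<Sum>l<N. (norm (x l))\<^sup>2) \<le> \<kappa> then x k else 0)"
        for x :: "nat \<Rightarrow> 'h" and k
      define g where "g x = h (Y x 0) (Y x (Suc 0))" for x
      have [measurable]: "(\<lambda>x. Y x k) \<in> borel_measurable (PiM {..<N} (\<lambda>_. borel))" if "k < N" for k
      proof -
        have [measurable]: "(\<lambda>x. x k) \<in> borel_measurable (PiM {..<N} (\<lambda>_. borel :: 'h measure))"
          using that by (intro measurable_component_singleton) simp
        show ?thesis unfolding Y_def by measurable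
      qed
      have "(\<lambda>x. case (Y x 0, Y x (Suc 0)) of (u, v) \<Rightarrow> h u v) \<in> borel_measurable (PiM {..<N} (\<lambda>_. borel))"
        using N by measurable
      then have g: "g \<in> borel_measurable (PiM {..<N} (\<lambda>_. borel))"
        by (simp add: g_def[abs_def])
      have g1: "g (\<lambda>k\<in>{..<N}. \<xi> (f k) \<omega>) = h (y i \<omega>) (y j \<omega>)" for \<omega>
        using sum.reindex_bij_betw[OF f, of "\<lambda>k. (norm (\<xi> k \<omega>))\<^sup>2"] N f01
        by (simp add: g_def Y_def y_def)
      have g2: "g (\<lambda>k\<in>{..<N}. \<xi> k \<omega>) = h (y 0 \<omega>) (y (Suc 0) \<omega>)" for \<omega>
        using N by (simp add: g_def Y_def y_def)
      show ?thesis
        using exchangeable_expectation[OF ex _ _ g, of f] f unfolding g1 g2 bij_betw_def by simp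
    qed
    define v where "v = expectation (\<lambda>\<omega>. (norm (y 0 \<omega>))\<^sup>2)"
    have v: "expectation (\<lambda>\<omega>. (norm (y i \<omega>))\<^sup>2) = v" if "i < N" for i
    proof -
      define j where "j = (if i = 0 then Suc 0 else 0)"
      have "j < N" "i \<noteq> j" using N by (auto simp: j_def)
      with exch[OF that, of j "\<lambda>u _. (norm u)\<^sup>2"] show ?thesis
        unfolding v_def by simp
    qed
    have "real N * v = expectation (\<lambda>\<omega>. \<Sum>i<N. (norm (y i \<omega>))\<^sup>2)"
      by (subst Bochner_Integration.integral_sum) (auto simp: inty v)
    also have "\<dots> \<le> expectation (\<lambda>\<omega>. \<kappa>)"
      by (intro integral_mono Bochner_Integration.integrable_sum inty sumy) auto
    finally have Nv: "real N * v \<le> \<kappa>" by (simp add: prob_space)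
    define c where "c i j = expectation (\<lambda>\<omega>. \<Psi> i (y i \<omega>) \<bullet> \<Psi> j (y j \<omega>))" for i j
    \<comment> \<open>\<open>G\<close> agrees with \<open>c\<close> off the diagonal but always
      evaluates at the fixed pair. Inside the expectation its double sum is therefore an inner
      product of two sums over \<Psi>, both zero.\<close>
    define G where "G i j = expectation (\<lambda>\<omega>. \<Psi> i (y 0 \<omega>) \<bullet> \<Psi> j (y (Suc 0) \<omega>))" for i j
    have cG: "c i j = G i j" if "i < N" "j < N" "i \<noteq> j" for i j
    proof -
      have "(\<lambda>(a, b). \<Psi> i a \<bullet> \<Psi> j b) \<in> borel_measurable (borel \<Otimes>\<^sub>M borel)"
        using that by measurable
      from exch[OF that this] show ?thesis unfolding c_def G_def .
    qed
    have "(\<Sum>i<N. \<Sum>j<N. G i j) = expectation (\<lambda>\<omega>. \<Sum>i<N. \<Sum>j<N. \<Psi> i (y 0 \<omega>) \<bullet> \<Psi> j (y (Suc 0) \<omega>))"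
      unfolding G_def using N by (intro dsum[symmetric] int)
    also have "(\<lambda>\<omega>. \<Sum>i<N. \<Sum>j<N. \<Psi> i (y 0 \<omega>) \<bullet> \<Psi> j (y (Suc 0) \<omega>))
        = (\<lambda>\<omega>. (\<Sum>i<N. \<Psi> i (y 0 \<omega>)) \<bullet> (\<Sum>j<N. \<Psi> j (y (Suc 0) \<omega>)))"
      unfolding inner_sum_right inner_sum_left by (intro ext sum.swap)
    finally have G0: "(\<Sum>i<N. \<Sum>j<N. G i j) = 0" by (simp add: centred)
    have ci: "c i i \<le> 4 * v" if "i < N" for i
    proof -
      have "c i i \<le> expectation (\<lambda>\<omega>. 4 * (norm (y i \<omega>))\<^sup>2)"
        unfolding c_def using inner_bound[OF that that] that
        by (intro integral_mono int integrable_mult_right inty)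
          (auto simp: power2_eq_square intro: order_trans[OF abs_ge_self])
      then show ?thesis using v[OF that] by simp
    qed
    have Gi: "- G i i \<le> 4 * v" if "i < N" for i
    proof -
      have pt: "- (\<Psi> i (y 0 \<omega>) \<bullet> \<Psi> i (y (Suc 0) \<omega>)) \<le> 2 * (norm (y 0 \<omega>))\<^sup>2 + 2 * (norm (y (Suc 0) \<omega>))\<^sup>2" for \<omega>
      proof -
        have "2 * (norm (y 0 \<omega>) * norm (y (Suc 0) \<omega>)) \<le> (norm (y 0 \<omega>))\<^sup>2 + (norm (y (Suc 0) \<omega>))\<^sup>2"
          using sum_squares_bound[of "norm (y 0 \<omega>)" "norm (y (Suc 0) \<omega>)"] by simp
        then show ?thesis
          using inner_bound[OF that that, of "y 0 \<omega>" "y (Suc 0) \<omega>"] by linarith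
      qed
      have "- G i i = expectation (\<lambda>\<omega>. - (\<Psi> i (y 0 \<omega>) \<bullet> \<Psi> i (y (Suc 0) \<omega>)))"
        unfolding G_def by simp
      also have "\<dots> \<le> expectation (\<lambda>\<omega>. 2 * (norm (y 0 \<omega>))\<^sup>2 + 2 * (norm (y (Suc 0) \<omega>))\<^sup>2)"
        using N that
        by (intro integral_mono pt Bochner_Integration.integrable_add integrable_minus int integrable_mult_right inty)
      also have "\<dots> = 4 * v"
        using N by (subst Bochner_Integration.integral_add) (auto simp: inty v)
      finally show ?thesis .
    qed
    have "expectation (\<lambda>\<omega>. (norm (\<Sum>i<N. \<Psi> i (y i \<omega>)))\<^sup>2) = (\<Sum>i<N. \<Sum>j<N. c i j)"
      unfolding sq c_def by (intro dsum int)
    also have "\<dots> = (\<Sum>i<N. (\<Sum>j<N. G i j) + (c i i - G i i))"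
    proof (intro sum.cong refl)
      fix i assume i: "i \<in> {..<N}"
      have "(\<Sum>j\<in>{..<N} - {i}. c i j) = (\<Sum>j\<in>{..<N} - {i}. G i j)"
        using i by (intro sum.cong refl cG) auto
      then show "(\<Sum>j<N. c i j) = (\<Sum>j<N. G i j) + (c i i - G i i)"
        using i by (simp add: sum.remove[of "{..<N}" i])
    qed
    also have "\<dots> = (\<Sum>i<N. c i i - G i i)" by (simp add: sum.distrib G0)
    also have "\<dots> \<le> (\<Sum>i<N. 8 * v)"
      using ci Gi by (intro sum_mono) force
    also have "\<dots> \<le> 8 * \<kappa>" using Nv by simp
    finally show ?thesis .
  qed
qed

text \<open>There are three exceptional events: the sum of squares exceeds \<kappa> = 8 \<eta>^2 (at
  most 24 \<eta>), the total sum exceeds \<eta> (at most \<eta>), and the centred part reaches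
  \<epsilon> / 2, where Chebyshev gives 8 \<kappa> / (\<epsilon> / 2)^2 = 256 \<eta>^2 /
  \<epsilon>^2. Off the first event the truncation is inactive.\<close>

lemma (in prob_space) exchangeable_operator_sum:
  fixes \<xi> :: "nat \<Rightarrow> 'a \<Rightarrow> 'h::{real_inner,second_countable_topology}"
    and \<Phi> :: "nat \<Rightarrow> 'h \<Rightarrow> 'h"
  assumes ex: "exchangeable M N \<xi>" and "\<eta> > 0" and "2 * \<eta> \<le> \<epsilon>"
    and small: "\<And>k. k \<le> N \<Longrightarrow> prob {\<omega>\<in>space M. \<eta> < norm (\<Sum>i<k. \<xi> i \<omega>)} \<le> \<eta>"
    and lin: "\<And>i. i < N \<Longrightarrow> bounded_linear (\<Phi> i)"
    and bound: "\<And>i x. i < N \<Longrightarrow> norm (\<Phi> i x) \<le> norm x"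
  shows "prob {\<omega>\<in>space M. \<epsilon> < norm (\<Sum>i<N. \<Phi> i (\<xi> i \<omega>))} \<le> 25 * \<eta> + 256 * \<eta>\<^sup>2 / \<epsilon>\<^sup>2"
proof (cases "N = 0")
  case True
  have "\<epsilon> > 0" using assms by linarith
  then show ?thesis using True \<open>\<eta> > 0\<close> by simp
next
  case False
  then have N: "N > 0" by simp
  have e: "\<epsilon> > 0" using assms by linarith
  have mx [measurable]: "i < N \<Longrightarrow> \<xi> i \<in> borel_measurable M" for i
    using exchangeable_measurable[OF ex] .
  define \<kappa> where "\<kappa> = 8 * \<eta>\<^sup>2"
  define T where "T x = (1 / real N) *\<^sub>R (\<Sum>j<N. \<Phi> j x)" for x
  define \<Psi> where "\<Psi> i x = \<Phi> i x - T x" for i x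
  define y where "y i \<omega> = (if (\<Sum>k<N. (norm (\<xi> k \<omega>))\<^sup>2) \<le> \<kappa> then \<xi> i \<omega> else 0)" for i \<omega>
  have T: "bounded_linear T"
    unfolding T_def[abs_def] by (intro bounded_linear_scaleR_right[THEN bounded_linear_compose] bounded_linear_sum lin) auto
  have T_bound: "norm (T x) \<le> norm x" for x
  proof -
    have "norm (\<Sum>j<N. \<Phi> j x) \<le> real N * norm x"
      using sum_norm_bound[of "{..<N}" "\<lambda>j. \<Phi> j x" "norm x"] bound by simp
    then show ?thesis using N by (simp add: T_def field_simps)
  qed
  have \<Psi>_lin: "bounded_linear (\<Psi> i)" if "i < N" for i
    unfolding \<Psi>_def[abs_def] using lin that T by (intro bounded_linear_sub) auto
  have \<Psi>_bound: "norm (\<Psi> i x) \<le> 2 * norm x" if "i < N" for i x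
    using norm_triangle_ineq4[of "\<Phi> i x" "T x"] bound[OF that, of x] T_bound[of x]
    unfolding \<Psi>_def by linarith
  have \<Psi>_sum: "(\<Sum>i<N. \<Psi> i x) = 0" for x
    using N by (simp add: \<Psi>_def sum_subtractf T_def scaleR_conv_of_real[symmetric] sum_constant_scaleR)
  have my [measurable]: "i < N \<Longrightarrow> y i \<in> borel_measurable M" for i
    unfolding y_def by measurable
  have m\<Psi> [measurable]: "i < N \<Longrightarrow> \<Psi> i \<in> borel_measurable borel" for i
    using \<Psi>_lin by (intro borel_measurable_continuous_onI linear_continuous_on)
  have k0: "\<kappa> \<ge> 0" by (simp add: \<kappa>_def)
  note sm = exchangeable_second_moment[OF ex k0 \<Psi>_lin \<Psi>_bound \<Psi>_sum, folded y_def]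
  let ?X = "\<lambda>\<omega>. (norm (\<Sum>i<N. \<Psi> i (y i \<omega>)))\<^sup>2"
  let ?E1 = "{\<omega>\<in>space M. \<kappa> < (\<Sum>k<N. (norm (\<xi> k \<omega>))\<^sup>2)}"
  let ?E2 = "{\<omega>\<in>space M. \<eta> < norm (\<Sum>i<N. \<xi> i \<omega>)}"
  let ?E3 = "{\<omega>\<in>space M. (\<epsilon> / 2)\<^sup>2 \<le> ?X \<omega>}"
  have E3: "prob ?E3 \<le> 8 * \<kappa> / (\<epsilon> / 2)\<^sup>2"
  proof -
    have "prob ?E3 \<le> expectation ?X / (\<epsilon> / 2)\<^sup>2"
      using e by (intro integral_Markov_inequality_measure[where A = "{}"] sm(1)) auto
    also have "\<dots> \<le> 8 * \<kappa> / (\<epsilon> / 2)\<^sup>2"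
      using sm(2) e by (intro divide_right_mono) auto
    finally show ?thesis .
  qed
  have sub: "{\<omega>\<in>space M. \<epsilon> < norm (\<Sum>i<N. \<Phi> i (\<xi> i \<omega>))} \<subseteq> ?E1 \<union> (?E2 \<union> ?E3)"
  proof (rule subsetI, rule ccontr)
    fix \<omega> assume w: "\<omega> \<in> {\<omega>\<in>space M. \<epsilon> < norm (\<Sum>i<N. \<Phi> i (\<xi> i \<omega>))}"
      and n: "\<omega> \<notin> ?E1 \<union> (?E2 \<union> ?E3)"
    have y: "y i \<omega> = \<xi> i \<omega>" for i using w n by (auto simp: y_def)
    have "(\<Sum>i<N. \<Phi> i (\<xi> i \<omega>)) = (\<Sum>i<N. \<Psi> i (y i \<omega>)) + T (\<Sum>i<N. \<xi> i \<omega>)"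
      unfolding y \<Psi>_def by (simp add: sum_subtractf linear_sum[OF bounded_linear.linear[OF T]])
    then have "norm (\<Sum>i<N. \<Phi> i (\<xi> i \<omega>)) \<le> norm (\<Sum>i<N. \<Psi> i (y i \<omega>)) + norm (\<Sum>i<N. \<xi> i \<omega>)"
      using norm_triangle_ineq[of "\<Sum>i<N. \<Psi> i (y i \<omega>)" "T (\<Sum>i<N. \<xi> i \<omega>)"] T_bound[of "\<Sum>i<N. \<xi> i \<omega>"]
      by simp
    moreover have "norm (\<Sum>i<N. \<xi> i \<omega>) \<le> \<epsilon> / 2" using w n \<open>2 * \<eta> \<le> \<epsilon>\<close> by auto
    moreover have "norm (\<Sum>i<N. \<Psi> i (y i \<omega>)) \<le> \<epsilon> / 2"
      using w n e by (auto simp: not_le intro: less_imp_le power2_less_imp_less)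
    ultimately show False using w by simp
  qed
  have "prob {\<omega>\<in>space M. \<epsilon> < norm (\<Sum>i<N. \<Phi> i (\<xi> i \<omega>))} \<le> prob (?E1 \<union> (?E2 \<union> ?E3))"
    by (intro finite_measure_mono sub) measurable
  also have "\<dots> \<le> prob ?E1 + prob (?E2 \<union> ?E3)"
    by (intro measure_Un_le) measurable
  also have "\<dots> \<le> prob ?E1 + (prob ?E2 + prob ?E3)"
    by (intro add_left_mono measure_Un_le) measurable
  also have "\<dots> \<le> 24 * \<eta> + (\<eta> + 8 * \<kappa> / (\<epsilon> / 2)\<^sup>2)"
    using exchangeable_sum_squares[OF ex \<open>\<eta> > 0\<close> small] small[of N] E3
    unfolding \<kappa>_def by (intro add_mono) auto
  also have "\<dots> = 25 * \<eta> + 256 * \<eta>\<^sup>2 / \<epsilon>\<^sup>2"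
    unfolding \<kappa>_def by (simp add: power_divide)
  finally show ?thesis .
qed

text \<open>\<eta> is fixed before N, the family and the operators. This uniformity is what permits
  arbitrarily fine grids.\<close>

lemma (in prob_space) exchangeable_operator_sum_small:
  assumes "\<epsilon> > 0"
  obtains \<eta> where "\<eta> > 0"
    "\<And>N (\<xi> :: nat \<Rightarrow> 'a \<Rightarrow> 'h::{real_inner,second_countable_topology}) (\<Phi> :: nat \<Rightarrow> 'h \<Rightarrow> 'h).
       exchangeable M N \<xi> \<Longrightarrow>
       (\<And>k. k \<le> N \<Longrightarrow> prob {\<omega>\<in>space M. \<eta> < norm (\<Sum>i<k. \<xi> i \<omega>)} \<le> \<eta>) \<Longrightarrow>
       (\<And>i. i < N \<Longrightarrow> bounded_linear (\<Phi> i)) \<Longrightarrow>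
       (\<And>i x. i < N \<Longrightarrow> norm (\<Phi> i x) \<le> norm x) \<Longrightarrow>
       prob {\<omega>\<in>space M. \<epsilon> < norm (\<Sum>i<N. \<Phi> i (\<xi> i \<omega>))} \<le> \<epsilon>"
proof
  \<comment> \<open>The first entry gives 2 \<eta> \<le> \<epsilon> and 25 \<eta> \<le> \<epsilon> /
    2. The second gives \<eta>^2 \<le> \<epsilon>^3 / 1024, so the quadratic term is at most
    \<epsilon> / 4.\<close>
  define \<eta> where "\<eta> = min (\<epsilon> / 50) (\<epsilon> * sqrt \<epsilon> / 32)"
  show pos: "\<eta> > 0" using \<open>\<epsilon> > 0\<close> by (simp add: \<eta>_def)
  fix N and \<xi> :: "nat \<Rightarrow> 'a \<Rightarrow> 'h" and \<Phi> :: "nat \<Rightarrow> 'h \<Rightarrow> 'h"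
  assume *: "exchangeable M N \<xi>" "\<And>k. k \<le> N \<Longrightarrow> prob {\<omega>\<in>space M. \<eta> < norm (\<Sum>i<k. \<xi> i \<omega>)} \<le> \<eta>"
    "\<And>i. i < N \<Longrightarrow> bounded_linear (\<Phi> i)" "\<And>i x. i < N \<Longrightarrow> norm (\<Phi> i x) \<le> norm x"
  have a: "\<eta> \<le> \<epsilon> / 50" by (simp add: \<eta>_def)
  have "\<eta>\<^sup>2 \<le> (\<epsilon> * sqrt \<epsilon> / 32)\<^sup>2" using pos by (intro power_mono) (auto simp: \<eta>_def)
  also have "\<dots> = \<epsilon>\<^sup>2 * \<epsilon> / 1024"
    using \<open>\<epsilon> > 0\<close> by (simp add: power_divide power_mult_distrib)
  finally have b: "256 * \<eta>\<^sup>2 / \<epsilon>\<^sup>2 \<le> \<epsilon> / 4"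
    using \<open>\<epsilon> > 0\<close> by (simp add: field_simps)
  have "prob {\<omega>\<in>space M. \<epsilon> < norm (\<Sum>i<N. \<Phi> i (\<xi> i \<omega>))} \<le> 25 * \<eta> + 256 * \<eta>\<^sup>2 / \<epsilon>\<^sup>2"
    using a \<open>\<epsilon> > 0\<close> by (intro exchangeable_operator_sum[OF *(1) pos _ *(2-4)]) auto
  also have "\<dots> \<le> \<epsilon>" using a b \<open>\<epsilon> > 0\<close> by linarith
  finally show "prob {\<omega>\<in>space M. \<epsilon> < norm (\<Sum>i<N. \<Phi> i (\<xi> i \<omega>))} \<le> \<epsilon>" .
qed

section \<open>Finite-rank approximation of the identity\<close>

text \<open>Gram--Schmidt in operator form: \<open>deflation d n\<close> is the projection onto the orthogonal complement
  of \<open>d 0, \<dots>, d (n - 1)\<close>.\<close>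

primrec deflation :: "(nat \<Rightarrow> 'h::real_inner) \<Rightarrow> nat \<Rightarrow> 'h \<Rightarrow> 'h" where
  "deflation d 0 = (\<lambda>x. x)"
| "deflation d (Suc n) = (\<lambda>x. deflation d n x
     - (sgn (deflation d n (d n)) \<bullet> deflation d n x) *\<^sub>R sgn (deflation d n (d n)))"

lemma bounded_linear_deflation: "bounded_linear (deflation d n)"
proof (induction n)
  case (Suc n)
  have "bounded_linear (\<lambda>x. (sgn (deflation d n (d n)) \<bullet> deflation d n x) *\<^sub>R sgn (deflation d n (d n)))"
    by (intro bounded_linear_scaleR_left[THEN bounded_linear_compose]
        bounded_linear_inner_right[THEN bounded_linear_compose] Suc)
  then show ?case using Suc by (simp add: bounded_linear_sub)
qed (simp add: bounded_linear_ident)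

lemma norm_deflation_Suc_le: "norm (deflation d (Suc n) x) \<le> norm (deflation d n x)"
proof -
  define u v where "u = sgn (deflation d n (d n))" and "v = deflation d n x"
  \<comment> \<open>If \<open>d n\<close> depends linearly on its predecessors, then
    \<open>u\<close> is \<open>sgn 0 = 0\<close> and the step is the identity; hence an inequality
    instead of 1.\<close>
  have "u \<bullet> u \<le> 1" by (simp add: u_def norm_sgn flip: power2_norm_eq_inner)
  then have "(u \<bullet> v)\<^sup>2 * (u \<bullet> u) \<le> (u \<bullet> v)\<^sup>2"
    by (simp add: mult_left_le)
  moreover have "(norm (v - (u \<bullet> v) *\<^sub>R u))\<^sup>2
      = (norm v)\<^sup>2 - 2 * (u \<bullet> v)\<^sup>2 + (u \<bullet> v)\<^sup>2 * (u \<bullet> u)"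
    unfolding power2_norm_eq_inner
    by (simp add: inner_diff_left inner_diff_right inner_commute power2_eq_square algebra_simps)
  ultimately have "(norm (v - (u \<bullet> v) *\<^sub>R u))\<^sup>2 \<le> (norm v)\<^sup>2"
    using zero_le_power2[of "u \<bullet> v"] by linarith
  then show ?thesis unfolding deflation.simps u_def[symmetric] v_def[symmetric]
    by (rule power2_le_imp_le) simp
qed

lemma norm_deflation_le: "norm (deflation d n x) \<le> norm x"
  by (induction n) (auto intro: order_trans[OF norm_deflation_Suc_le] simp del: deflation.simps(2))

lemma deflation_eq_0: "n < m \<Longrightarrow> deflation d m (d n) = 0"
proof (induction m)
  case (Suc m)
  show ?case
  proof (cases "n < m")
    case True
    then show ?thesis using Suc.IH by simp
  next
    case False
    with Suc.prems have [simp]: "m = n" by simp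
    define w where "w = deflation d n (d n)"
    have "sgn w \<bullet> w = norm w"
      by (cases "w = 0") (auto simp: sgn_div_norm power2_norm_eq_inner[symmetric] power2_eq_square)
    then have "w - (sgn w \<bullet> w) *\<^sub>R sgn w = 0" by (cases "w = 0") (simp_all add: sgn_div_norm)
    then show ?thesis by (simp add: w_def)
  qed
qed simp

text \<open>\<open>deflation d n\<close> is a linear contraction that kills \<open>d k\<close> for k
  < n, so its value at x is bounded by the distance from x to any such \<open>d k\<close>.\<close>

lemma deflation_tendsto_0:
  assumes "closure (range d) = UNIV"
  shows "(\<lambda>n. deflation d n x) \<longlonglongrightarrow> 0"
proof (rule LIMSEQ_I)
  fix e :: real assume "e > 0"
  then obtain k where k: "norm (x - d k) < e"
    using assms closure_approachable[of x "range d"] by (auto simp: dist_norm norm_minus_commute)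
  have "norm (deflation d n x - 0) < e" if "n \<ge> Suc k" for n
  proof -
    have "deflation d n x = deflation d n (x - d k)"
      using deflation_eq_0[of k n d] that
      by (simp add: linear_diff[OF bounded_linear.linear[OF bounded_linear_deflation]])
    then show ?thesis using norm_deflation_le[of d n "x - d k"] k by simp
  qed
  then show "\<exists>no. \<forall>n\<ge>no. norm (deflation d n x - 0) < e" by blast
qed

text \<open>The complementary part lies in the span of n vectors that do not depend on x, with
  coefficients at most \<open>norm x\<close>. Strong continuity of \<open>R\<close> is applied to
  these vectors.\<close>

lemma deflation_eq_diff_sum:
  "deflation d n x = x - (\<Sum>i<n. (sgn (deflation d i (d i)) \<bullet> deflation d i x) *\<^sub>R sgn (deflation d i (d i)))"
  by (induction n) (auto simp: algebra_simps)

lemma exists_dense_sequence: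
  obtains d :: "nat \<Rightarrow> 'h::second_countable_topology" where "closure (range d) = UNIV"
proof -
  obtain D :: "'h set" where D: "countable D" "\<And>X. open X \<Longrightarrow> X \<noteq> {} \<Longrightarrow> \<exists>d\<in>D. d \<in> X"
    using countable_dense_setE by blast
  have ne: "D \<noteq> {}" using D(2)[of UNIV] by auto
  have "closure D = UNIV"
    using D(2)[of "- closure D"] closure_subset[of D] by (auto simp: open_Compl)
  then show thesis using that[of "from_nat_into D"] range_from_nat_into[OF ne D(1)] by simp
qed

section \<open>Convergence in probability\<close>

lemma Cauchy_of_geometric_steps:
  fixes x :: "nat \<Rightarrow> 'b::metric_space"
  assumes "eventually (\<lambda>j. dist (x j) (x (Suc j)) \<le> (1 / 2) ^ j) sequentially"
  shows "Cauchy x"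
proof -
  obtain N where N: "\<And>j. j \<ge> N \<Longrightarrow> dist (x j) (x (Suc j)) \<le> (1 / 2) ^ j"
    using assms unfolding eventually_sequentially by blast
  \<comment> \<open>The right side is the exact sum of the geometric bounds; the subtracted term
    lets the induction close.\<close>
  have step: "dist (x n) (x (n + k)) \<le> 2 * (1 / 2) ^ n - 2 * (1 / 2) ^ (n + k)" if "n \<ge> N" for n k
  proof (induction k)
    case (Suc k)
    then show ?case
      using dist_triangle[of "x n" "x (n + Suc k)" "x (n + k)"] N[of "n + k"] that by simp
  qed simp
  have le: "dist (x n) (x m) \<le> 2 * (1 / 2) ^ n" if "N \<le> n" "n \<le> m" for n m
    using step[OF that(1), of "m - n"] that(2) zero_le_power[of "1 / 2 :: real" m]
    by (simp del: zero_le_power)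
  show ?thesis
  proof (rule metric_CauchyI)
    fix e :: real assume "e > 0"
    have "(\<lambda>n. 2 * (1 / 2 :: real) ^ n) \<longlonglongrightarrow> 2 * 0"
      by (intro tendsto_mult tendsto_const LIMSEQ_power_zero) simp
    then have "eventually (\<lambda>n. 2 * (1 / 2 :: real) ^ n < e) sequentially"
      using \<open>e > 0\<close> by (intro order_tendstoD) auto
    then obtain K where K: "\<And>n. n \<ge> K \<Longrightarrow> 2 * (1 / 2 :: real) ^ n < e"
      unfolding eventually_sequentially by blast
    have "dist (x m) (x n) < e" if "m \<ge> max K N" "n \<ge> max K N" for m n
    proof (cases "m \<le> n")
      case True
      then show ?thesis using le[of m n] K[of m] that by simp
    next
      case False
      then show ?thesis using le[of n m] K[of n] that by (simp add: dist_commute)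
    qed
    then show "\<exists>L. \<forall>m\<ge>L. \<forall>n\<ge>L. dist (x m) (x n) < e" by blast
  qed
qed

context prob_space
begin

lemma prob_dist_triangle:
  fixes X Y W :: "'a \<Rightarrow> 'b::{metric_space,second_countable_topology}"
  assumes [measurable]: "X \<in> borel_measurable M" "Y \<in> borel_measurable M" "W \<in> borel_measurable M"
    and "a + b \<le> c"
  shows "prob {\<omega>\<in>space M. c < dist (X \<omega>) (W \<omega>)}
    \<le> prob {\<omega>\<in>space M. a < dist (X \<omega>) (Y \<omega>)} + prob {\<omega>\<in>space M. b < dist (Y \<omega>) (W \<omega>)}"
proof -
  have sub: "{\<omega>\<in>space M. c < dist (X \<omega>) (W \<omega>)}
      \<subseteq> {\<omega>\<in>space M. a < dist (X \<omega>) (Y \<omega>)} \<union> {\<omega>\<in>space M. b < dist (Y \<omega>) (W \<omega>)}"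
  proof
    fix \<omega> assume "\<omega> \<in> {\<omega>\<in>space M. c < dist (X \<omega>) (W \<omega>)}"
    then show "\<omega> \<in> {\<omega>\<in>space M. a < dist (X \<omega>) (Y \<omega>)} \<union> {\<omega>\<in>space M. b < dist (Y \<omega>) (W \<omega>)}"
      using dist_triangle[of "X \<omega>" "W \<omega>" "Y \<omega>"] \<open>a + b \<le> c\<close> by auto
  qed
  have "prob {\<omega>\<in>space M. c < dist (X \<omega>) (W \<omega>)}
      \<le> prob ({\<omega>\<in>space M. a < dist (X \<omega>) (Y \<omega>)} \<union> {\<omega>\<in>space M. b < dist (Y \<omega>) (W \<omega>)})"
    by (intro finite_measure_mono sub) measurable
  also have "\<dots> \<le> prob {\<omega>\<in>space M. a < dist (X \<omega>) (Y \<omega>)} + prob {\<omega>\<in>space M. b < dist (Y \<omega>) (W \<omega>)}"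
    by (intro measure_Un_le) measurable
  finally show ?thesis .
qed

lemma AE_imp_conv_in_prob:
  fixes X :: "nat \<Rightarrow> 'a \<Rightarrow> 'b::{metric_space,second_countable_topology}"
  assumes [measurable]: "\<And>n. X n \<in> borel_measurable M" "Y \<in> borel_measurable M"
    and lim: "AE \<omega> in M. (\<lambda>n. X n \<omega>) \<longlonglongrightarrow> Y \<omega>"
  shows "conv_in_prob M X Y"
  unfolding conv_in_prob_def
proof (intro allI impI)
  fix e :: real assume "e > 0"
  let ?B = "\<lambda>n. {\<omega>\<in>space M. e < dist (X n \<omega>) (Y \<omega>)}"
  have "(\<lambda>n. expectation (indicator (?B n) :: 'a \<Rightarrow> real)) \<longlonglongrightarrow> expectation (\<lambda>_. 0)"
  proof (rule integral_dominated_convergence[where w = "\<lambda>_. 1"])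
    show "AE \<omega> in M. (\<lambda>n. indicator (?B n) \<omega> :: real) \<longlonglongrightarrow> 0"
      using lim
    proof eventually_elim
      case (elim \<omega>)
      have "eventually (\<lambda>n. dist (X n \<omega>) (Y \<omega>) < e) sequentially"
        using elim \<open>e > 0\<close> by (rule tendstoD)
      then have "eventually (\<lambda>n. (indicator (?B n) \<omega> :: real) = 0) sequentially"
        by eventually_elim (auto simp: indicator_def)
      then show ?case by (rule tendsto_eventually)
    qed
  qed (auto simp: indicator_def)
  then show "(\<lambda>n. prob (?B n)) \<longlonglongrightarrow> 0" by simp
qed

text \<open>A subsequence with summable exceptional probabilities converges almost surely by
  Borel-Cantelli, and the Cauchy property carries its limit over to the whole sequence.\<close>

lemma conv_in_prob_of_Cauchy_in_prob:
  fixes X :: "nat \<Rightarrow> 'a \<Rightarrow> 'b::{complete_space,second_countable_topology}"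
  assumes [measurable]: "\<And>n. X n \<in> borel_measurable M"
    and cauchy: "\<And>e. e > 0 \<Longrightarrow> \<exists>K. \<forall>m\<ge>K. \<forall>n\<ge>K. prob {\<omega>\<in>space M. e < dist (X m \<omega>) (X n \<omega>)} \<le> e"
  obtains Y where "Y \<in> borel_measurable M" "conv_in_prob M X Y"
proof -
  have "\<forall>j. \<exists>K. \<forall>m\<ge>K. \<forall>n\<ge>K. prob {\<omega>\<in>space M. (1 / 2) ^ j < dist (X m \<omega>) (X n \<omega>)} \<le> (1 / 2) ^ j"
    by (intro allI cauchy) simp
  then obtain K where K: "\<And>j m n. m \<ge> K j \<Longrightarrow> n \<ge> K j \<Longrightarrow>
      prob {\<omega>\<in>space M. (1 / 2) ^ j < dist (X m \<omega>) (X n \<omega>)} \<le> (1 / 2) ^ j"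
    by metis
  \<comment> \<open>Adding all \<open>K i\<close> with i \<le> j puts both \<open>r j\<close> and
    \<open>r (Suc j)\<close> beyond \<open>K j\<close> although \<open>K\<close> may oscillate; the
    summand j makes \<open>r\<close> unbounded.\<close>
  define r where "r j = j + (\<Sum>i\<le>j. K i)" for j :: nat
  have r: "r j \<ge> K j" "r (Suc j) \<ge> K j" "r j \<ge> j" for j
    using member_le_sum[of j "{..j}" K] by (auto simp: r_def)
  \<comment> \<open>A constant off the convergence set makes \<open>Y\<close> an everywhere
    pointwise limit of measurable functions.\<close>
  define Y where "Y \<omega> = (if Cauchy (\<lambda>j. X (r j) \<omega>) then lim (\<lambda>j. X (r j) \<omega>) else undefined)" for \<omega>
  have CM: "{\<omega>\<in>space M. Cauchy (\<lambda>j. X (r j) \<omega>)} \<in> sets M"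
    by (rule sets_Collect_Cauchy) simp
  have mY [measurable]: "Y \<in> borel_measurable M"
  proof (rule borel_measurable_LIMSEQ_metric)
    show "(\<lambda>\<omega>. if Cauchy (\<lambda>j. X (r j) \<omega>) then X (r i) \<omega> else undefined) \<in> borel_measurable M" for i
      by (intro measurable_If CM) auto
    show "(\<lambda>i. if Cauchy (\<lambda>j. X (r j) \<omega>) then X (r i) \<omega> else undefined) \<longlonglongrightarrow> Y \<omega>" for \<omega>
      by (auto simp: Y_def Cauchy_convergent_iff convergent_LIMSEQ_iff)
  qed
  let ?A = "\<lambda>j. {\<omega>\<in>space M. (1 / 2) ^ j < dist (X (r j) \<omega>) (X (r (Suc j)) \<omega>)}"
  have "AE \<omega> in M. eventually (\<lambda>j. \<omega> \<in> space M - ?A j) sequentially"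
  proof (rule borel_cantelli_AE1)
    show "summable (\<lambda>j. prob (?A j))"
      by (rule summable_comparison_test[OF _ summable_geometric[of "1 / 2 :: real"]]) (use K r in auto)
  qed (auto simp: less_top[symmetric])
  then have "AE \<omega> in M. (\<lambda>j. X (r j) \<omega>) \<longlonglongrightarrow> Y \<omega>"
  proof eventually_elim
    case (elim \<omega>)
    then have "eventually (\<lambda>j. dist (X (r j) \<omega>) (X (r (Suc j)) \<omega>) \<le> (1 / 2) ^ j) sequentially"
      by eventually_elim auto
    then have "Cauchy (\<lambda>j. X (r j) \<omega>)" by (rule Cauchy_of_geometric_steps)
    then show ?case by (simp add: Y_def Cauchy_convergent_iff convergent_LIMSEQ_iff)
  qed
  then have sub: "conv_in_prob M (\<lambda>j. X (r j)) Y"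
    by (intro AE_imp_conv_in_prob) auto
  have "conv_in_prob M X Y"
    unfolding conv_in_prob_def
  proof (intro allI impI LIMSEQ_I)
    fix e d :: real assume "e > 0" "d > 0"
    define c where "c = min (e / 2) (d / 4)"
    have c: "c > 0" "c + c \<le> e" "c \<le> d / 4" using \<open>e > 0\<close> \<open>d > 0\<close> by (auto simp: c_def)
    obtain L where L: "\<And>m n. m \<ge> L \<Longrightarrow> n \<ge> L \<Longrightarrow> prob {\<omega>\<in>space M. c < dist (X m \<omega>) (X n \<omega>)} \<le> c"
      using cauchy[OF c(1)] by blast
    have "(\<lambda>j. prob {\<omega>\<in>space M. c < dist (X (r j) \<omega>) (Y \<omega>)}) \<longlonglongrightarrow> 0"
      using sub c(1) unfolding conv_in_prob_def by blast
    then have "eventually (\<lambda>j. prob {\<omega>\<in>space M. c < dist (X (r j) \<omega>) (Y \<omega>)} < d / 4) sequentially"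
      using \<open>d > 0\<close> by (intro order_tendstoD) auto
    then obtain j where j: "j \<ge> L" "prob {\<omega>\<in>space M. c < dist (X (r j) \<omega>) (Y \<omega>)} < d / 4"
      unfolding eventually_sequentially by (metis nat_le_linear)
    have "norm (prob {\<omega>\<in>space M. e < dist (X n \<omega>) (Y \<omega>)} - 0) < d" if "n \<ge> L" for n
    proof -
      have "prob {\<omega>\<in>space M. e < dist (X n \<omega>) (Y \<omega>)}
        \<le> prob {\<omega>\<in>space M. c < dist (X n \<omega>) (X (r j) \<omega>)} + prob {\<omega>\<in>space M. c < dist (X (r j) \<omega>) (Y \<omega>)}"
        using c by (intro prob_dist_triangle) auto
      also have "\<dots> < d" using L[OF that, of "r j"] r(3)[of j] j c \<open>d > 0\<close> by fastforce
      finally show ?thesis by simp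
    qed
    then show "\<exists>no. \<forall>n\<ge>no. norm (prob {\<omega>\<in>space M. e < dist (X n \<omega>) (Y \<omega>)} - 0) < d" by blast
  qed
  then show thesis using that[of Y] mY by blast
qed

end

section \<open>Operations on limits in probability and uniqueness of the limit law\<close>

lemma conv_in_prob_Suc: "conv_in_prob M X Y \<Longrightarrow> conv_in_prob M (\<lambda>n. X (Suc n)) Y"
  unfolding conv_in_prob_def
  using LIMSEQ_Suc[where f = "\<lambda>n. measure M {\<omega>\<in>space M. _ < dist (X n \<omega>) (Y \<omega>)}"] by blast

lemma conv_in_prob_lipschitz:
  fixes X :: "nat \<Rightarrow> 'a \<Rightarrow> 'b::{metric_space,second_countable_topology}"
  assumes X: "conv_in_prob M X Y" and f: "\<And>x y. dist (f x) (f y) \<le> K * dist x y" and "prob_space M"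
    and [measurable]: "\<And>n. X n \<in> borel_measurable M" "Y \<in> borel_measurable M"
  shows "conv_in_prob M (\<lambda>n \<omega>. f (X n \<omega>)) (\<lambda>\<omega>. f (Y \<omega>))"
  unfolding conv_in_prob_def
proof (intro allI impI)
  interpret prob_space M by fact
  fix e :: real assume "e > 0"
  \<comment> \<open>The maximum guarantees a positive constant to divide by.\<close>
  define L where "L = max K 1"
  have fL: "dist (f x) (f y) \<le> L * dist x y" for x y
    using f[of x y] mult_right_mono[of K L "dist x y"] by (simp add: L_def)
  have L: "L > 0" by (simp add: L_def)
  have "(\<lambda>n. prob {\<omega>\<in>space M. e / L < dist (X n \<omega>) (Y \<omega>)}) \<longlonglongrightarrow> 0"
    using X \<open>e > 0\<close> L unfolding conv_in_prob_def by simp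
  then show "(\<lambda>n. prob {\<omega>\<in>space M. e < dist (f (X n \<omega>)) (f (Y \<omega>))}) \<longlonglongrightarrow> 0"
  proof (rule tendsto_0_le[where K = 1], intro always_eventually allI)
    fix n
    have "prob {\<omega>\<in>space M. e < dist (f (X n \<omega>)) (f (Y \<omega>))} \<le> prob {\<omega>\<in>space M. e / L < dist (X n \<omega>) (Y \<omega>)}"
    proof (rule finite_measure_mono)
      show "{\<omega>\<in>space M. e < dist (f (X n \<omega>)) (f (Y \<omega>))} \<subseteq> {\<omega>\<in>space M. e / L < dist (X n \<omega>) (Y \<omega>)}"
      proof safe
        fix \<omega> assume "e < dist (f (X n \<omega>)) (f (Y \<omega>))"
        then have "e < L * dist (X n \<omega>) (Y \<omega>)" using fL[of "X n \<omega>" "Y \<omega>"] by linarith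
        then show "e / L < dist (X n \<omega>) (Y \<omega>)" using L by (simp add: field_simps)
      qed
    qed measurable
    then show "norm (prob {\<omega>\<in>space M. e < dist (f (X n \<omega>)) (f (Y \<omega>))})
        \<le> norm (prob {\<omega>\<in>space M. e / L < dist (X n \<omega>) (Y \<omega>)}) * 1" by simp
  qed
qed

lemma conv_in_prob_add:
  fixes X X' :: "nat \<Rightarrow> 'a \<Rightarrow> 'b::{real_normed_vector,second_countable_topology}"
  assumes X: "conv_in_prob M X Y" and X': "conv_in_prob M X' Y'" and "prob_space M"
    and [measurable]: "\<And>n. X n \<in> borel_measurable M" "Y \<in> borel_measurable M"
      "\<And>n. X' n \<in> borel_measurable M" "Y' \<in> borel_measurable M"
  shows "conv_in_prob M (\<lambda>n \<omega>. X n \<omega> + X' n \<omega>) (\<lambda>\<omega>. Y \<omega> + Y' \<omega>)"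
  unfolding conv_in_prob_def
proof (intro allI impI)
  interpret prob_space M by fact
  fix e :: real assume "e > 0"
  let ?p = "\<lambda>n. prob {\<omega>\<in>space M. e / 2 < dist (X n \<omega>) (Y \<omega>)} + prob {\<omega>\<in>space M. e / 2 < dist (X' n \<omega>) (Y' \<omega>)}"
  have "?p \<longlonglongrightarrow> 0 + 0"
    using X X' half_gt_zero[OF \<open>e > 0\<close>] unfolding conv_in_prob_def by (intro tendsto_add) blast+
  then have "?p \<longlonglongrightarrow> 0" by simp
  then show "(\<lambda>n. prob {\<omega>\<in>space M. e < dist (X n \<omega> + X' n \<omega>) (Y \<omega> + Y' \<omega>)}) \<longlonglongrightarrow> 0"
  proof (rule tendsto_0_le[where K = 1], intro always_eventually allI)
    fix n
    have "prob {\<omega>\<in>space M. e < dist (X n \<omega> + X' n \<omega>) (Y \<omega> + Y' \<omega>)}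
      \<le> prob {\<omega>\<in>space M. e / 2 < dist (X n \<omega> + X' n \<omega>) (Y \<omega> + X' n \<omega>)}
        + prob {\<omega>\<in>space M. e / 2 < dist (Y \<omega> + X' n \<omega>) (Y \<omega> + Y' \<omega>)}"
      by (intro prob_dist_triangle) auto
    then show "norm (prob {\<omega>\<in>space M. e < dist (X n \<omega> + X' n \<omega>) (Y \<omega> + Y' \<omega>)}) \<le> norm (?p n) * 1"
      by simp
  qed
qed

lemma conv_in_prob_sum:
  fixes X :: "'i \<Rightarrow> nat \<Rightarrow> 'a \<Rightarrow> 'b::{real_normed_vector,second_countable_topology}"
  assumes "finite I" "prob_space M" "\<And>i. i \<in> I \<Longrightarrow> conv_in_prob M (X i) (Y i)"
    "\<And>i n. i \<in> I \<Longrightarrow> X i n \<in> borel_measurable M" "\<And>i. i \<in> I \<Longrightarrow> Y i \<in> borel_measurable M"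
  shows "conv_in_prob M (\<lambda>n \<omega>. \<Sum>i\<in>I. X i n \<omega>) (\<lambda>\<omega>. \<Sum>i\<in>I. Y i \<omega>)"
  using assms(1,3-5)
proof (induction I rule: finite_induct)
  case empty
  show ?case by (simp add: conv_in_prob_def)
next
  case (insert i I)
  have "conv_in_prob M (\<lambda>n \<omega>. X i n \<omega> + (\<Sum>i\<in>I. X i n \<omega>)) (\<lambda>\<omega>. Y i \<omega> + (\<Sum>i\<in>I. Y i \<omega>))"
    using insert.prems insert.IH by (intro conv_in_prob_add \<open>prob_space M\<close> borel_measurable_sum) auto
  then show ?case using insert.hyps by simp
qed

text \<open>A portmanteau argument across two spaces. If \<open>Y\<close> is in C, then
  \<open>X n\<close> is within e of C off a small event; equality of laws transfers this to
  \<open>X' n\<close>, and then \<open>Y'\<close> is within 2 e off another small event. Let n grow,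
  then e shrink, using that C is closed. The empty set is excluded because \<open>infdist\<close> to
  it is 0.\<close>

lemma measure_le_of_conv_in_prob:
  fixes X :: "nat \<Rightarrow> 'a \<Rightarrow> 'h::{metric_space,second_countable_topology}" and X' :: "nat \<Rightarrow> 'b \<Rightarrow> 'h"
  assumes "prob_space M" "prob_space M'"
    and [measurable]: "\<And>n. X n \<in> borel_measurable M" "Y \<in> borel_measurable M"
      "\<And>n. X' n \<in> borel_measurable M'" "Y' \<in> borel_measurable M'"
    and conv: "conv_in_prob M X Y" "conv_in_prob M' X' Y'"
    and eq: "\<And>n. distr M borel (X n) = distr M' borel (X' n)"
    and C: "closed C" "C \<noteq> {}"
  shows "measure (distr M borel Y) C \<le> measure (distr M' borel Y') C"
proof -
  interpret M: prob_space M by fact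
  interpret M': prob_space M' by fact
  define D where "D e = {x. infdist x C \<le> e}" for e
  have [measurable]: "D e \<in> sets borel" for e
    unfolding D_def by (intro borel_closed closed_Collect_le continuous_on_infdist continuous_on_id continuous_on_const)
  have D: "measure (distr M borel Y) C \<le> measure (distr M' borel Y') (D (2 * e))" if "e > 0" for e
  proof (rule LIMSEQ_le_const)
    let ?p = "\<lambda>n. M.prob {\<omega>\<in>space M. e < dist (X n \<omega>) (Y \<omega>)}"
    let ?p' = "\<lambda>n. M'.prob {\<omega>\<in>space M'. e < dist (X' n \<omega>) (Y' \<omega>)}"
    have "(\<lambda>n. measure (distr M' borel Y') (D (2 * e)) + ?p' n + ?p n)
        \<longlonglongrightarrow> measure (distr M' borel Y') (D (2 * e)) + 0 + 0"
      using conv that unfolding conv_in_prob_def by (intro tendsto_intros) auto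
    then show "(\<lambda>n. measure (distr M' borel Y') (D (2 * e)) + ?p' n + ?p n)
        \<longlonglongrightarrow> measure (distr M' borel Y') (D (2 * e))" by simp
    have le: "measure (distr M borel Y) C \<le> measure (distr M' borel Y') (D (2 * e)) + ?p' n + ?p n" for n
    proof -
      have "measure (distr M borel Y) C = M.prob (Y -` C \<inter> space M)"
        using C by (simp add: measure_distr)
      also have "\<dots> \<le> M.prob ((X n -` D e \<inter> space M) \<union> {\<omega>\<in>space M. e < dist (X n \<omega>) (Y \<omega>)})"
      proof (intro M.finite_measure_mono subsetI)
        fix \<omega> assume w: "\<omega> \<in> Y -` C \<inter> space M"
        then have "infdist (X n \<omega>) C \<le> dist (X n \<omega>) (Y \<omega>)" by (intro infdist_le) auto
        then show "\<omega> \<in> (X n -` D e \<inter> space M) \<union> {\<omega>\<in>space M. e < dist (X n \<omega>) (Y \<omega>)}"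
          using w by (auto simp: D_def)
      qed measurable
      also have "\<dots> \<le> M.prob (X n -` D e \<inter> space M) + ?p n"
        by (intro measure_Un_le) measurable
      also have "M.prob (X n -` D e \<inter> space M) = measure (distr M borel (X n)) (D e)"
        by (simp add: measure_distr)
      also have "\<dots> = M'.prob (X' n -` D e \<inter> space M')"
        unfolding eq by (simp add: measure_distr)
      also have "\<dots> \<le> M'.prob ((Y' -` D (2 * e) \<inter> space M') \<union> {\<omega>\<in>space M'. e < dist (X' n \<omega>) (Y' \<omega>)})"
      proof (intro M'.finite_measure_mono subsetI)
        fix \<omega> assume w: "\<omega> \<in> X' n -` D e \<inter> space M'"
        then have "infdist (Y' \<omega>) C \<le> e + dist (X' n \<omega>) (Y' \<omega>)"
          using infdist_triangle[of "Y' \<omega>" C "X' n \<omega>"] by (auto simp: D_def dist_commute)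
        then show "\<omega> \<in> (Y' -` D (2 * e) \<inter> space M') \<union> {\<omega>\<in>space M'. e < dist (X' n \<omega>) (Y' \<omega>)}"
          using w by (auto simp: D_def)
      qed measurable
      also have "\<dots> \<le> M'.prob (Y' -` D (2 * e) \<inter> space M') + ?p' n"
        by (intro measure_Un_le) measurable
      also have "M'.prob (Y' -` D (2 * e) \<inter> space M') = measure (distr M' borel Y') (D (2 * e))"
        by (simp add: measure_distr)
      finally show ?thesis by simp
    qed
    then show "\<exists>N. \<forall>n\<ge>N. measure (distr M borel Y) C \<le> measure (distr M' borel Y') (D (2 * e)) + ?p' n + ?p n"
      by blast
  qed
  interpret P': prob_space "distr M' borel Y'" by (rule M'.prob_space_distr) simp
  have "(\<lambda>k. measure (distr M' borel Y') (D (2 * (1 / real (Suc k))))) \<longlonglongrightarrow>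
      measure (distr M' borel Y') (\<Inter>k. D (2 * (1 / real (Suc k))))"
  proof (rule P'.finite_Lim_measure_decseq)
    show "decseq (\<lambda>k. D (2 * (1 / real (Suc k))))"
      unfolding decseq_def D_def
    proof (intro allI impI subsetI)
      fix m n :: nat and x assume "m \<le> n" "x \<in> {x. infdist x C \<le> 2 * (1 / real (Suc n))}"
      moreover have "2 * (1 / real (Suc n)) \<le> 2 * (1 / real (Suc m))"
        using \<open>m \<le> n\<close> by (simp add: frac_le)
      ultimately show "x \<in> {x. infdist x C \<le> 2 * (1 / real (Suc m))}" by auto
    qed
  qed auto
  moreover have "(\<Inter>k. D (2 * (1 / real (Suc k)))) = C"
  proof (intro subset_antisym subsetI)
    fix x assume x: "x \<in> (\<Inter>k. D (2 * (1 / real (Suc k))))"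
    have "(\<lambda>k. 2 * (1 / real (Suc k))) \<longlonglongrightarrow> 2 * 0"
      by (intro tendsto_mult tendsto_const lim_inverse_n'[THEN LIMSEQ_Suc])
    then have "infdist x C \<le> 2 * 0"
      by (rule LIMSEQ_le_const) (use x in \<open>auto simp: D_def\<close>)
    then have "infdist x C = 0" using infdist_nonneg[of x C] by linarith
    then show "x \<in> C" using C in_closed_iff_infdist_zero by blast
  qed (auto simp: D_def)
  ultimately have lim: "(\<lambda>k. measure (distr M' borel Y') (D (2 * (1 / real (Suc k))))) \<longlonglongrightarrow>
      measure (distr M' borel Y') C" by simp
  show ?thesis
    by (rule LIMSEQ_le_const[OF lim]) (intro exI[of _ 0] allI impI D, simp)
qed

text \<open>Closed sets form an intersection-stable generator of the Borel sets. Two spaces are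
  allowed because the limits to be compared live on \<open>M\<close> and on its n-fold
  power.\<close>

lemma distr_eq_of_conv_in_prob:
  fixes X :: "nat \<Rightarrow> 'a \<Rightarrow> 'h::{metric_space,second_countable_topology}" and X' :: "nat \<Rightarrow> 'b \<Rightarrow> 'h"
  assumes M: "prob_space M" "prob_space M'"
    and meas: "\<And>n. X n \<in> borel_measurable M" "Y \<in> borel_measurable M"
      "\<And>n. X' n \<in> borel_measurable M'" "Y' \<in> borel_measurable M'"
    and conv: "conv_in_prob M X Y" "conv_in_prob M' X' Y'"
    and eq: "\<And>n. distr M borel (X n) = distr M' borel (X' n)"
  shows "distr M borel Y = distr M' borel Y'"
proof (rule measure_eqI_generator_eq[where E = "Collect closed" and A = "\<lambda>_. UNIV" and \<Omega> = UNIV])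
  interpret P: prob_space "distr M borel Y" by (rule prob_space.prob_space_distr[OF M(1) meas(2)])
  interpret P': prob_space "distr M' borel Y'" by (rule prob_space.prob_space_distr[OF M(2) meas(4)])
  show "emeasure (distr M borel Y) C = emeasure (distr M' borel Y') C" if "C \<in> Collect closed" for C
  proof (cases "C = {}")
    case False
    have "measure (distr M borel Y) C = measure (distr M' borel Y') C"
    proof (rule antisym)
      show "measure (distr M borel Y) C \<le> measure (distr M' borel Y') C"
        using that False by (intro measure_le_of_conv_in_prob[OF M meas conv eq]) auto
      show "measure (distr M' borel Y') C \<le> measure (distr M borel Y) C"
        using that False by (intro measure_le_of_conv_in_prob[OF M(2,1) meas(3,4,1,2) conv(2,1) eq[symmetric]]) auto
    qed
    then show ?thesis by (simp add: P.emeasure_eq_measure P'.emeasure_eq_measure)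
  qed simp
  show "Int_stable (Collect closed)" by (auto simp: Int_stable_def)
  show "sets (distr M borel Y) = sigma_sets UNIV (Collect closed)"
    "sets (distr M' borel Y') = sigma_sets UNIV (Collect closed)"
    by (simp_all add: borel_eq_closed)
qed (auto simp: prob_space.emeasure_space_1[OF prob_space.prob_space_distr[OF M(1) meas(2)], simplified])

section \<open>Riemann sums for processes with stationary independent increments\<close>

text \<open>These properties pass to the time-changed process \<open>Z (u / c)\<close>, as
  divisibility requires. Stochastic continuity is sequential because it is applied to extracted
  subsequences of times and to refining grids.\<close>

locale stationary_increments = prob_space M for M :: "'a measure" +
  fixes Z :: "real \<Rightarrow> 'a \<Rightarrow> 'h::{real_inner,complete_space,second_countable_topology}"
  assumes measurable_process: "\<And>u. 0 \<le> u \<Longrightarrow> Z u \<in> borel_measurable M"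
    and indep_increments: "\<And>(n::nat) r. 0 \<le> r 0 \<Longrightarrow> (\<And>k. k < n \<Longrightarrow> r k \<le> r (Suc k)) \<Longrightarrow>
          indep_vars (\<lambda>_. borel) (\<lambda>k \<omega>. Z (r (Suc k)) \<omega> - Z (r k) \<omega>) {..<n}"
    and stationary: "\<And>s h. 0 \<le> s \<Longrightarrow> 0 \<le> h \<Longrightarrow>
          distr M borel (\<lambda>\<omega>. Z (s + h) \<omega> - Z s \<omega>) = distr M borel (\<lambda>\<omega>. Z h \<omega> - Z 0 \<omega>)"
    and stochastically_continuous: "\<And>u v. (\<And>k. 0 \<le> u k) \<Longrightarrow> 0 \<le> v \<Longrightarrow> u \<longlonglongrightarrow> v \<Longrightarrow>
          conv_in_prob M (\<lambda>k. Z (u k)) (Z v)"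
begin

definition increment :: "real \<Rightarrow> nat \<Rightarrow> 'a \<Rightarrow> 'h" where
  "increment h k \<omega> = Z (real (Suc k) * h) \<omega> - Z (real k * h) \<omega>"

lemma measurable_increment:
  "0 \<le> h \<Longrightarrow> increment h k \<in> borel_measurable M"
  unfolding increment_def[abs_def] by (intro borel_measurable_diff measurable_process) auto

lemma indep_vars_increment:
  "0 \<le> h \<Longrightarrow> indep_vars (\<lambda>_. borel) (increment h) {..<n}"
  using indep_increments[of "\<lambda>k. real k * h" n]
  by (simp add: increment_def[abs_def] mult_right_mono)

lemma distr_increment:
  "0 \<le> h \<Longrightarrow> distr M borel (increment h k) = distr M borel (\<lambda>\<omega>. Z h \<omega> - Z 0 \<omega>)"
  using stationary[of "real k * h" h]
  by (simp add: increment_def[abs_def] distrib_right add.commute)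

lemma distr_increments:
  assumes h: "0 \<le> h" and I: "finite I" "I \<noteq> {}" "inj_on f I"
  shows "distr M (PiM I (\<lambda>_. borel)) (\<lambda>\<omega>. \<lambda>i\<in>I. increment h (f i) \<omega>)
    = PiM I (\<lambda>_. distr M borel (\<lambda>\<omega>. Z h \<omega> - Z 0 \<omega>))"
proof -
  define \<kappa> where "\<kappa> = distr M borel (\<lambda>\<omega>. Z h \<omega> - Z 0 \<omega>)"
  \<comment> \<open>Independence is given for consecutive increments, so the selected ones are read
    off as coordinates of the vector of all increments up to the largest index.\<close>
  define n where "n = Suc (Max (f ` I))"
  have f: "f i < n" if "i \<in> I" for i
    using I that by (auto simp: n_def less_Suc_eq_le)
  have sets_\<kappa>: "sets \<kappa> = sets borel" by (simp add: \<kappa>_def)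
  have \<kappa>: "prob_space \<kappa>"
    unfolding \<kappa>_def using h by (intro prob_space_distr borel_measurable_diff measurable_process) auto
  have S': "sets (PiM I (\<lambda>_. \<kappa>)) = sets (PiM I (\<lambda>_. borel))"
    by (intro sets_PiM_cong refl sets_\<kappa>)
  have "distr M (PiM {..<n} (\<lambda>_. borel)) (\<lambda>\<omega>. \<lambda>i\<in>{..<n}. increment h i \<omega>) = PiM {..<n} (\<lambda>i. distr M borel (increment h i))"
    using indep_vars_increment[OF h, of n] measurable_increment[OF h]
    by (subst (asm) indep_vars_iff_distr_eq_PiM') (auto simp: n_def)
  also have "\<dots> = PiM {..<n} (\<lambda>_. \<kappa>)"
    by (simp add: distr_increment[OF h] \<kappa>_def)
  finally have eq: "PiM {..<n} (\<lambda>_. \<kappa>) = distr M (PiM {..<n} (\<lambda>_. borel)) (\<lambda>\<omega>. \<lambda>i\<in>{..<n}. increment h i \<omega>)" ..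
  have m1: "(\<lambda>\<omega>. \<lambda>i\<in>{..<n}. increment h i \<omega>) \<in> measurable M (PiM {..<n} (\<lambda>_. borel))"
    by (intro measurable_restrict measurable_increment h)
  have m2: "(\<lambda>x. \<lambda>i\<in>I. x (f i)) \<in> measurable (PiM {..<n} (\<lambda>_. borel)) (PiM I (\<lambda>_. borel :: 'h measure))"
    using f by (intro measurable_restrict measurable_component_singleton) auto
  have "PiM I (\<lambda>_. \<kappa>) = distr (PiM {..<n} (\<lambda>_. \<kappa>)) (PiM I (\<lambda>_. \<kappa>)) (\<lambda>x. \<lambda>i\<in>I. x (f i))"
    using \<kappa> f I by (intro distr_PiM_reindex[symmetric]) auto
  also have "\<dots> = distr (PiM {..<n} (\<lambda>_. \<kappa>)) (PiM I (\<lambda>_. borel)) (\<lambda>x. \<lambda>i\<in>I. x (f i))"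
    by (intro distr_cong refl S')
  also have "\<dots> = distr M (PiM I (\<lambda>_. borel)) (\<lambda>\<omega>. \<lambda>i\<in>I. increment h (f i) \<omega>)"
    unfolding eq distr_distr[OF m2 m1] using f by (intro distr_cong refl) (auto simp: fun_eq_iff)
  finally show ?thesis unfolding \<kappa>_def ..
qed

text \<open>An i.i.d. family is exchangeable. The injection \<open>g\<close> serves to enumerate the
  increments backwards in time.\<close>

lemma exchangeable_increments:
  assumes h: "0 \<le> h" and g: "inj_on g {..<N}"
  shows "exchangeable M N (\<lambda>i. increment h (g i))"
  unfolding exchangeable_def
proof (intro conjI allI impI measurable_increment h)
  fix m :: nat and f :: "nat \<Rightarrow> nat"
  assume f: "inj_on f {..<m} \<and> f ` {..<m} \<subseteq> {..<N}"
  show "distr M (PiM {..<m} (\<lambda>_. borel)) (\<lambda>\<omega>. \<lambda>i\<in>{..<m}. increment h (g (f i)) \<omega>) =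
        distr M (PiM {..<m} (\<lambda>_. borel)) (\<lambda>\<omega>. \<lambda>i\<in>{..<m}. increment h (g i) \<omega>)"
  proof (cases "m = 0")
    case False
    have "m \<le> N" using card_inj_on_le[of f "{..<m}" "{..<N}"] f by simp
    then have "inj_on g {..<m}" by (intro inj_on_subset[OF g]) auto
    moreover have "inj_on (\<lambda>i. g (f i)) {..<m}"
      using comp_inj_on[of f "{..<m}" g] inj_on_subset[OF g, of "f ` {..<m}"] f by (simp add: comp_def)
    ultimately show ?thesis
      using False distr_increments[OF h, of "{..<m}" "\<lambda>i. g (f i)"] distr_increments[OF h, of "{..<m}" g]
      by (simp add: lessThan_empty_iff)
  qed (simp add: restrict_def)
qed

text \<open>Otherwise bad times, one for each n, accumulate at some l. As the \<open>V n\<close> are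
  contractions, \<open>V n (Z s)\<close> is close to \<open>V n (Z l)\<close> for s near l,
  uniformly in n, and \<open>V n (Z l)\<close> tends to 0 pointwise.\<close>

lemma uniformly_small_in_prob:
  fixes V :: "nat \<Rightarrow> 'h \<Rightarrow> 'h"
  assumes lin: "\<And>n. bounded_linear (V n)" and bound: "\<And>n x. norm (V n x) \<le> norm x"
    and lim: "\<And>x. (\<lambda>n. V n x) \<longlonglongrightarrow> 0" and "0 < \<eta>"
  shows "\<exists>n. \<forall>s\<in>{0..T}. prob {\<omega>\<in>space M. \<eta> < norm (V n (Z s \<omega>))} \<le> \<eta>"
proof (rule ccontr)
  assume "\<not> ?thesis"
  then have "\<forall>n. \<exists>s. s \<in> {0..T} \<and> \<eta> < prob {\<omega>\<in>space M. \<eta> < norm (V n (Z s \<omega>))}"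
    by (simp add: not_le Bex_def)
  then obtain s where s: "\<And>n. s n \<in> {0..T}" "\<And>n. \<eta> < prob {\<omega>\<in>space M. \<eta> < norm (V n (Z (s n) \<omega>))}"
    by metis
  obtain l r where l: "l \<in> {0..T}" and r: "strict_mono r" and conv: "(s \<circ> r) \<longlonglongrightarrow> l"
    using compact_Icc[of 0 T] s(1) unfolding compact_def by metis
  have mV [measurable]: "V n \<in> borel_measurable borel" for n
    using lin by (intro borel_measurable_continuous_onI linear_continuous_on)
  have [measurable]: "Z (s n) \<in> borel_measurable M" "Z l \<in> borel_measurable M" for n
    using s(1)[of n] l by (auto intro!: measurable_process)
  let ?a = "\<lambda>n. prob {\<omega>\<in>space M. \<eta> / 2 < dist (Z (s (r n)) \<omega>) (Z l \<omega>)}"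
  let ?b = "\<lambda>n. prob {\<omega>\<in>space M. \<eta> / 2 < dist (V (r n) (Z l \<omega>)) 0}"
  have \<eta>2: "\<eta> / 2 > 0" using \<open>0 < \<eta>\<close> by simp
  have "conv_in_prob M (\<lambda>k. Z ((s \<circ> r) k)) (Z l)"
    using s(1) l by (intro stochastically_continuous conv) auto
  then have a: "?a \<longlonglongrightarrow> 0"
    using \<eta>2 unfolding conv_in_prob_def comp_def by blast
  have "conv_in_prob M (\<lambda>k \<omega>. V (r k) (Z l \<omega>)) (\<lambda>_. 0)"
    using LIMSEQ_subseq_LIMSEQ[OF lim r] by (intro AE_imp_conv_in_prob) (auto simp: comp_def)
  then have b: "?b \<longlonglongrightarrow> 0"
    using \<eta>2 unfolding conv_in_prob_def by blast
  have "\<eta> \<le> ?a n + ?b n" for n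
  proof -
    have "prob {\<omega>\<in>space M. \<eta> < dist (V (r n) (Z (s (r n)) \<omega>)) 0}
      \<le> prob {\<omega>\<in>space M. \<eta> / 2 < dist (V (r n) (Z (s (r n)) \<omega>)) (V (r n) (Z l \<omega>))} + ?b n"
      by (intro prob_dist_triangle) auto
    also have "prob {\<omega>\<in>space M. \<eta> / 2 < dist (V (r n) (Z (s (r n)) \<omega>)) (V (r n) (Z l \<omega>))} \<le> ?a n"
    proof (rule finite_measure_mono)
      have "dist (V k x) (V k y) \<le> dist x y" for k x y
        using bound[of k "x - y"] by (simp add: dist_norm linear_diff[OF bounded_linear.linear[OF lin]])
      then show "{\<omega>\<in>space M. \<eta> / 2 < dist (V (r n) (Z (s (r n)) \<omega>)) (V (r n) (Z l \<omega>))}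
        \<subseteq> {\<omega>\<in>space M. \<eta> / 2 < dist (Z (s (r n)) \<omega>) (Z l \<omega>)}"
        by (auto intro: less_le_trans)
    qed measurable
    finally show ?thesis using s(2)[of "r n"] by simp
  qed
  then have "\<eta> \<le> 0 + 0"
    by (intro LIMSEQ_le_const[OF tendsto_add[OF a b]]) blast
  then show False using \<open>0 < \<eta>\<close> by simp
qed

end

section \<open>Operator-weighted sums over the backward grid\<close>

lemma borel_measurable_blinfun_apply_const:
  fixes B :: "'h::{real_normed_vector,second_countable_topology} \<Rightarrow>\<^sub>L 'h"
  assumes "X \<in> borel_measurable M"
  shows "(\<lambda>\<omega>. blinfun_apply B (X \<omega>)) \<in> borel_measurable M"
  using assms by (rule measurable_compose)
    (intro borel_measurable_continuous_onI linear_continuous_on blinfun.bounded_linear_right)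

locale stochastic_convolution = stationary_increments M Z
  for M :: "'a measure" and Z :: "real \<Rightarrow> 'a \<Rightarrow> 'h::{real_inner,complete_space,second_countable_topology}" +
  fixes R :: "real \<Rightarrow> 'h \<Rightarrow>\<^sub>L 'h" and t :: real and C :: real
  assumes t_pos: "0 < t"
    and R_bound: "\<And>u. u \<in> {0..t} \<Longrightarrow> norm (R u) \<le> C"
    and R_continuous: "\<And>x. continuous_on {0..t} (\<lambda>u. blinfun_apply (R u) x)"
begin

text \<open>Enumerated backwards in time, since the integrand is \<open>R (t - \<tau>)\<close>.\<close>

definition grid_increment :: "nat \<Rightarrow> nat \<Rightarrow> 'a \<Rightarrow> 'h" where
  "grid_increment L l \<omega> = Z (t - real l * (t / real L)) \<omega> - Z (t - real (Suc l) * (t / real L)) \<omega>"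

definition grid_sum :: "nat \<Rightarrow> 'a \<Rightarrow> 'h" where
  "grid_sum L \<omega> = (\<Sum>l<L. blinfun_apply (R (real l * (t / real L))) (grid_increment L l \<omega>))"

text \<open>Here \<open>p\<close> partitions the reversed time t - \<tau>: its cell i is the time
  interval from \<open>t - p (Suc i)\<close> to \<open>t - p i\<close>.\<close>

definition riemann_sum :: "nat \<Rightarrow> (nat \<Rightarrow> real) \<Rightarrow> (nat \<Rightarrow> real) \<Rightarrow> 'a \<Rightarrow> 'h" where
  "riemann_sum N p s \<omega> = (\<Sum>i<N. blinfun_apply (R (s i)) (Z (t - p i) \<omega> - Z (t - p (Suc i)) \<omega>))"

lemma grid_point_le: "l \<le> L \<Longrightarrow> real l * (t / real L) \<le> t"
  using t_pos by (cases "L = 0") (auto simp: field_simps)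

lemma grid_increment_eq:
  assumes "l < L" shows "grid_increment L l = increment (t / real L) (L - Suc l)"
proof -
  have "t - real k * (t / real L) = real (L - k) * (t / real L)" if "k \<le> L" for k
    using that assms by (simp add: of_nat_diff field_simps)
  from this[of l] this[of "Suc l"] show ?thesis
    using assms unfolding grid_increment_def[abs_def] increment_def[abs_def]
    by (simp add: Suc_diff_Suc)
qed

lemma exchangeable_grid_increment: "exchangeable M L (grid_increment L)"
proof -
  have ex: "exchangeable M L (\<lambda>l. increment (t / real L) (L - Suc l))"
    using t_pos by (intro exchangeable_increments) (auto simp: inj_on_def)
  have eq: "(\<lambda>\<omega>. \<lambda>i\<in>{..<m}. grid_increment L (f i) \<omega>) = (\<lambda>\<omega>. \<lambda>i\<in>{..<m}. increment (t / real L) (L - Suc (f i)) \<omega>)"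
    if "f ` {..<m} \<subseteq> {..<L}" for f and m :: nat
    using that by (intro ext restrict_ext) (auto simp: grid_increment_eq)
  show ?thesis unfolding exchangeable_def
  proof (intro conjI allI impI)
    show "grid_increment L i \<in> borel_measurable M" if "i < L" for i
      using exchangeable_measurable[OF ex that] that by (simp add: grid_increment_eq)
    fix m :: nat and f :: "nat \<Rightarrow> nat" assume f: "inj_on f {..<m} \<and> f ` {..<m} \<subseteq> {..<L}"
    have "m \<le> L" using card_inj_on_le[of f "{..<m}" "{..<L}"] f by simp
    then have e: "(\<lambda>\<omega>. \<lambda>i\<in>{..<m}. grid_increment L i \<omega>) = (\<lambda>\<omega>. \<lambda>i\<in>{..<m}. increment (t / real L) (L - Suc i) \<omega>)"
      by (intro eq) auto
    show "distr M (PiM {..<m} (\<lambda>_. borel)) (\<lambda>\<omega>. \<lambda>i\<in>{..<m}. grid_increment L (f i) \<omega>) =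
        distr M (PiM {..<m} (\<lambda>_. borel)) (\<lambda>\<omega>. \<lambda>i\<in>{..<m}. grid_increment L i \<omega>)"
      unfolding eq[OF conjunct2[OF f]] e
      by (rule exchangeable_distr[OF ex conjunct1[OF f] conjunct2[OF f] measurable_ident_sets[OF refl]])
  qed
qed

lemma sum_grid_increment:
  assumes "m \<le> n"
  shows "(\<Sum>l\<in>{m..<n}. grid_increment L l \<omega>) = Z (t - real m * (t / real L)) \<omega> - Z (t - real n * (t / real L)) \<omega>"
  using sum_Suc_diff'[OF assms, of "\<lambda>l. - Z (t - real l * (t / real L)) \<omega>"]
  by (simp add: grid_increment_def)

lemma measurable_grid_sum [measurable]: "grid_sum L \<in> borel_measurable M"
  unfolding grid_sum_def[abs_def]
  by (intro borel_measurable_sum borel_measurable_blinfun_apply_const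
      exchangeable_measurable[OF exchangeable_grid_increment]) auto

text \<open>Strong continuity gives a modulus for each vector, and finitely many moduli have a
  positive minimum. On the unit ball this may fail, which forces the finite-dimensional
  reduction.\<close>

lemma uniform_continuity_on_finite_set:
  assumes "0 < \<rho>" "finite U"
  shows "\<exists>\<delta>>0. \<forall>a\<in>{0..t}. \<forall>b\<in>{0..t}. \<bar>a - b\<bar> \<le> \<delta> \<longrightarrow>
    (\<forall>u\<in>U. norm (blinfun_apply (R a) u - blinfun_apply (R b) u) \<le> \<rho>)"
  using \<open>finite U\<close>
proof (induction U rule: finite_induct)
  case empty
  show ?case by (intro exI[of _ 1]) auto
next
  case (insert u U)
  then obtain \<delta>1 where d1: "\<delta>1 > 0" "\<forall>a\<in>{0..t}. \<forall>b\<in>{0..t}. \<bar>a - b\<bar> \<le> \<delta>1 \<longrightarrow>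
    (\<forall>u\<in>U. norm (blinfun_apply (R a) u - blinfun_apply (R b) u) \<le> \<rho>)" by blast
  have "uniformly_continuous_on {0..t} (\<lambda>a. blinfun_apply (R a) u)"
    by (intro compact_uniformly_continuous R_continuous compact_Icc)
  then obtain \<delta>2 where d2: "\<delta>2 > 0" "\<And>a b. a \<in> {0..t} \<Longrightarrow> b \<in> {0..t} \<Longrightarrow> dist b a < \<delta>2 \<Longrightarrow>
    dist (blinfun_apply (R b) u) (blinfun_apply (R a) u) < \<rho>"
    unfolding uniformly_continuous_on_def using \<open>0 < \<rho>\<close> by blast
  show ?case
  proof (intro exI[of _ "min \<delta>1 (\<delta>2 / 2)"] conjI ballI impI)
    show "0 < min \<delta>1 (\<delta>2 / 2)" using d1 d2 by simp
    fix a b v assume ab: "a \<in> {0..t}" "b \<in> {0..t}" "\<bar>a - b\<bar> \<le> min \<delta>1 (\<delta>2 / 2)" "v \<in> insert u U"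
    have "norm (blinfun_apply (R a) u - blinfun_apply (R b) u) \<le> \<rho>"
      using d2(2)[OF ab(2,1)] ab(3) d2(1) by (simp add: dist_norm dist_real_def)
    then show "norm (blinfun_apply (R a) v - blinfun_apply (R b) v) \<le> \<rho>"
      using ab d1(2) by auto
  qed
qed


text \<open>Split x into \<open>V x\<close> and \<open>x - V x\<close> with \<open>V\<close> a
  deflation. On the first part the operators are merely bounded by c, but \<open>V (Z s)\<close> is
  uniformly small. On the second part, \<open>Z\<close> is merely bounded in probability, but the
  operators are at most \<rho> in norm once \<delta> is chosen after \<open>V\<close> and \<rho>.
  Rescaling turns both parts into sums with contractions.\<close>

lemma operator_sum_small:
  assumes "0 < \<epsilon>"
  shows "\<exists>\<delta>>0. \<forall>L a b. (\<forall>l<L. a l \<in> {0..t} \<and> b l \<in> {0..t} \<and> \<bar>a l - b l\<bar> \<le> \<delta>) \<longrightarrow>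
    prob {\<omega>\<in>space M. \<epsilon> < norm (\<Sum>l<L. blinfun_apply (R (a l) - R (b l)) (grid_increment L l \<omega>))} \<le> \<epsilon>"
proof -
  have C0: "0 \<le> C" using R_bound[of 0] t_pos order_trans[OF norm_ge_zero] by simp
  define c where "c = 2 * C + 1"
  have c: "1 \<le> c" "2 * C \<le> c" using C0 by (auto simp: c_def)
  \<comment> \<open>The second sum is scaled back by c, and c \<epsilon>1 = \<epsilon> / 2. Since c
    \<ge> 1, also the two probabilities add up to at most \<epsilon>.\<close>
  define \<epsilon>1 where "\<epsilon>1 = \<epsilon> / (2 * c)"
  have e1: "0 < \<epsilon>1" using c \<open>0 < \<epsilon>\<close> by (simp add: \<epsilon>1_def)
  have e1_le: "\<epsilon>1 \<le> \<epsilon> / 2" using c \<open>0 < \<epsilon>\<close> by (simp add: \<epsilon>1_def field_simps)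
  obtain \<eta> where \<eta>: "\<eta> > 0"
    and small: "\<And>N (\<xi> :: nat \<Rightarrow> 'a \<Rightarrow> 'h) (\<Phi> :: nat \<Rightarrow> 'h \<Rightarrow> 'h).
       exchangeable M N \<xi> \<Longrightarrow>
       (\<And>k. k \<le> N \<Longrightarrow> prob {\<omega>\<in>space M. \<eta> < norm (\<Sum>i<k. \<xi> i \<omega>)} \<le> \<eta>) \<Longrightarrow>
       (\<And>i. i < N \<Longrightarrow> bounded_linear (\<Phi> i)) \<Longrightarrow>
       (\<And>i x. i < N \<Longrightarrow> norm (\<Phi> i x) \<le> norm x) \<Longrightarrow>
       prob {\<omega>\<in>space M. \<epsilon>1 < norm (\<Sum>i<N. \<Phi> i (\<xi> i \<omega>))} \<le> \<epsilon>1"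
    using exchangeable_operator_sum_small[OF e1, where 'h = 'h] by blast
  \<comment> \<open>The images of the first k grid increments telescope to
    \<open>V (Z t) - V (Z s)\<close>, so a bound with \<eta> / 2 at single times controls all
    partial sums.\<close>
  have small': "prob {\<omega>\<in>space M. \<epsilon>1 < norm (\<Sum>i<L. \<Phi> i (V (grid_increment L i \<omega>)))} \<le> \<epsilon>1"
    if V: "bounded_linear V" and VZ: "\<And>s. s \<in> {0..t} \<Longrightarrow> prob {\<omega>\<in>space M. \<eta> / 2 < norm (V (Z s \<omega>))} \<le> \<eta> / 2"
      and \<Phi>: "\<And>i. i < L \<Longrightarrow> bounded_linear (\<Phi> i)" "\<And>i x. i < L \<Longrightarrow> norm (\<Phi> i x) \<le> norm x"
    for V :: "'h \<Rightarrow> 'h" and \<Phi> :: "nat \<Rightarrow> 'h \<Rightarrow> 'h" and L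
  proof (rule small[OF _ _ \<Phi>])
    have mV [measurable]: "V \<in> borel_measurable borel"
      using V by (intro borel_measurable_continuous_onI linear_continuous_on)
    show "exchangeable M L (\<lambda>i \<omega>. V (grid_increment L i \<omega>))"
      by (rule exchangeable_compose[OF exchangeable_grid_increment mV])
    fix k assume "k \<le> L"
    define s where "s = t - real k * (t / real L)"
    have s: "s \<in> {0..t}"
      using grid_point_le[OF \<open>k \<le> L\<close>] t_pos by (auto simp: s_def)
    have [measurable]: "Z t \<in> borel_measurable M" "Z s \<in> borel_measurable M"
      using s t_pos by (auto intro!: measurable_process)
    have "(\<Sum>i<k. V (grid_increment L i \<omega>)) = V (Z t \<omega>) - V (Z s \<omega>)" for \<omega>
      using sum_grid_increment[of 0 k L \<omega>]
      by (simp add: s_def atLeast0LessThan bounded_linear.linear[OF V]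
          flip: linear_sum[OF bounded_linear.linear[OF V]] linear_diff[OF bounded_linear.linear[OF V]])
    then have "prob {\<omega>\<in>space M. \<eta> < norm (\<Sum>i<k. V (grid_increment L i \<omega>))}
        = prob {\<omega>\<in>space M. \<eta> < dist (V (Z t \<omega>)) (V (Z s \<omega>))}"
      by (simp add: dist_norm)
    also have "\<dots> \<le> prob {\<omega>\<in>space M. \<eta> / 2 < dist (V (Z t \<omega>)) 0} + prob {\<omega>\<in>space M. \<eta> / 2 < dist 0 (V (Z s \<omega>))}"
      by (intro prob_dist_triangle) auto
    also have "\<dots> \<le> \<eta>" using VZ[OF s] VZ[of t] t_pos by simp
    finally show "prob {\<omega>\<in>space M. \<eta> < norm (\<Sum>i<k. V (grid_increment L i \<omega>))} \<le> \<eta>" .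
  qed
  obtain d :: "nat \<Rightarrow> 'h" where d: "closure (range d) = UNIV"
    using exists_dense_sequence .
  have \<eta>2: "\<eta> / 2 > 0" using \<eta> by simp
  obtain n where n: "\<And>s. s \<in> {0..t} \<Longrightarrow> prob {\<omega>\<in>space M. \<eta> / 2 < norm (deflation d n (Z s \<omega>))} \<le> \<eta> / 2"
    using uniformly_small_in_prob[of "deflation d", OF bounded_linear_deflation norm_deflation_le
        deflation_tendsto_0[OF d] \<eta>2, of t] by blast
  have lim: "(\<lambda>m. inverse (real (Suc m)) *\<^sub>R x) \<longlonglongrightarrow> 0" for x :: 'h
    using tendsto_scaleR[OF LIMSEQ_inverse_real_of_nat tendsto_const, of x] by simp
  have le: "norm (inverse (real (Suc m)) *\<^sub>R x) \<le> norm x" for m and x :: 'h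
    by (simp add: mult_left_le_one_le inverse_le_1_iff)
  \<comment> \<open>With shrinking multiples of the identity the compactness lemma says that
    \<open>Z\<close> is bounded in probability on [0, t]; it provides a factor \<rho> that makes
    \<rho> \<open>Z\<close> uniformly small.\<close>
  obtain m where m: "\<And>s. s \<in> {0..t} \<Longrightarrow>
      prob {\<omega>\<in>space M. \<eta> / 2 < norm (inverse (real (Suc m)) *\<^sub>R Z s \<omega>)} \<le> \<eta> / 2"
    using uniformly_small_in_prob[of "\<lambda>m x. inverse (real (Suc m)) *\<^sub>R x",
        OF bounded_linear_scaleR_right le lim \<eta>2, of t] by blast
  define \<rho> where "\<rho> = inverse (real (Suc m))"
  have \<rho>: "\<rho> > 0" by (simp add: \<rho>_def)
  define V where "V = deflation d n"
  define u where "u i = sgn (deflation d i (d i))" for i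
  have V: "bounded_linear V" unfolding V_def by (rule bounded_linear_deflation)
  have \<rho>n: "0 < \<rho> / real (Suc n)" using \<rho> by simp
  \<comment> \<open>n vectors with error at most \<rho> / (n + 1) each contribute at most \<rho>
    together; \<open>Suc n\<close> covers n = 0.\<close>
  obtain \<delta> where \<delta>: "\<delta> > 0" "\<And>a b v. a \<in> {0..t} \<Longrightarrow> b \<in> {0..t} \<Longrightarrow> \<bar>a - b\<bar> \<le> \<delta> \<Longrightarrow> v \<in> u ` {..<n} \<Longrightarrow>
      norm (blinfun_apply (R a) v - blinfun_apply (R b) v) \<le> \<rho> / real (Suc n)"
    using uniform_continuity_on_finite_set[OF \<rho>n finite_imageI[OF finite_lessThan[of n]], of u] by blast
  show ?thesis
  proof (intro exI[of _ \<delta>] conjI allI impI \<delta>(1))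
    fix L :: nat and a b :: "nat \<Rightarrow> real"
    assume ab: "\<forall>l<L. a l \<in> {0..t} \<and> b l \<in> {0..t} \<and> \<bar>a l - b l\<bar> \<le> \<delta>"
    let ?\<Psi> = "\<lambda>l. blinfun_apply (R (a l) - R (b l))"
    have \<Psi>_bound: "norm (?\<Psi> l x) \<le> c * norm x" if "l < L" for l x
    proof -
      have "norm (R (a l) - R (b l)) \<le> norm (R (a l)) + norm (R (b l))" by (rule norm_triangle_ineq4)
      also have "\<dots> \<le> c" using ab that R_bound[of "a l"] R_bound[of "b l"] c(2) by simp
      finally have "norm (R (a l) - R (b l)) * norm x \<le> c * norm x"
        by (rule mult_right_mono) simp
      then show ?thesis using norm_blinfun[of "R (a l) - R (b l)" x] by linarith
    qed
    have \<Psi>_finite: "norm (?\<Psi> l (x - V x)) \<le> \<rho> * norm x" if "l < L" for l x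
    proof -
      have "?\<Psi> l (x - V x) = (\<Sum>i<n. (u i \<bullet> deflation d i x) *\<^sub>R ?\<Psi> l (u i))"
        unfolding V_def deflation_eq_diff_sum[of d n x] u_def[symmetric]
        by (simp add: blinfun.sum_right blinfun.scaleR_right)
      also have "norm \<dots> \<le> (\<Sum>i<n. norm x * (\<rho> / real (Suc n)))"
      proof (intro order_trans[OF norm_sum] sum_mono)
        fix i assume i: "i \<in> {..<n}"
        have "\<bar>u i \<bullet> deflation d i x\<bar> \<le> norm (u i) * norm (deflation d i x)"
          by (rule Cauchy_Schwarz_ineq2)
        also have "\<dots> \<le> 1 * norm x"
          by (intro mult_mono norm_deflation_le) (auto simp: u_def norm_sgn)
        finally have "\<bar>u i \<bullet> deflation d i x\<bar> \<le> norm x" by simp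
        moreover have "norm (?\<Psi> l (u i)) \<le> \<rho> / real (Suc n)"
          using \<delta>(2)[of "a l" "b l" "u i"] ab that i by (simp add: blinfun.diff_left)
        ultimately show "norm ((u i \<bullet> deflation d i x) *\<^sub>R ?\<Psi> l (u i)) \<le> norm x * (\<rho> / real (Suc n))"
          unfolding norm_scaleR by (intro mult_mono) simp_all
      qed
      also have "\<dots> = (real n / real (Suc n)) * (\<rho> * norm x)" by simp
      also have "\<dots> \<le> 1 * (\<rho> * norm x)" using \<rho> by (intro mult_right_mono) auto
      finally show ?thesis by simp
    qed
    have lin\<Psi>: "bounded_linear (?\<Psi> l)" for l by (rule blinfun.bounded_linear_right)
    have mg [measurable]: "l < L \<Longrightarrow> grid_increment L l \<in> borel_measurable M" for l
      by (rule exchangeable_measurable[OF exchangeable_grid_increment])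
    have mV [measurable]: "V \<in> borel_measurable borel" "?\<Psi> l \<in> borel_measurable borel" for l
      using V lin\<Psi> by (auto intro!: borel_measurable_continuous_onI linear_continuous_on)
    \<comment> \<open>The factor \<rho> moves from the operators to the increments: \<Psi> (x - V x)
      / \<rho> is a contraction, applied to \<rho> times an increment.\<close>
    let ?S1 = "\<lambda>\<omega>. \<Sum>l<L. (1 / \<rho>) *\<^sub>R ?\<Psi> l (\<rho> *\<^sub>R grid_increment L l \<omega> - V (\<rho> *\<^sub>R grid_increment L l \<omega>))"
    let ?S2 = "\<lambda>\<omega>. \<Sum>l<L. (1 / c) *\<^sub>R ?\<Psi> l (V (grid_increment L l \<omega>))"
    have P1: "prob {\<omega>\<in>space M. \<epsilon>1 < norm (?S1 \<omega>)} \<le> \<epsilon>1"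
    proof (rule small'[of "\<lambda>x. \<rho> *\<^sub>R x" L "\<lambda>l x. (1 / \<rho>) *\<^sub>R ?\<Psi> l (x - V x)"])
      show "bounded_linear (\<lambda>x. (1 / \<rho>) *\<^sub>R ?\<Psi> l (x - V x))" for l
        by (intro bounded_linear_scaleR_right[THEN bounded_linear_compose] lin\<Psi>[THEN bounded_linear_compose]
            bounded_linear_sub bounded_linear_ident V)
      show "norm ((1 / \<rho>) *\<^sub>R ?\<Psi> l (x - V x)) \<le> norm x" if "l < L" for l x
        using \<Psi>_finite[OF that, of x] \<rho> by (simp add: field_simps)
      show "prob {\<omega>\<in>space M. \<eta> / 2 < norm (\<rho> *\<^sub>R Z s \<omega>)} \<le> \<eta> / 2" if "s \<in> {0..t}" for s
        using m[OF that] unfolding \<rho>_def .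
    qed (rule bounded_linear_scaleR_right)
    have P2: "prob {\<omega>\<in>space M. \<epsilon>1 < norm (?S2 \<omega>)} \<le> \<epsilon>1"
    proof (rule small'[OF V, of L "\<lambda>l x. (1 / c) *\<^sub>R ?\<Psi> l x"])
      show "bounded_linear (\<lambda>x. (1 / c) *\<^sub>R ?\<Psi> l x)" for l
        by (intro bounded_linear_scaleR_right[THEN bounded_linear_compose] lin\<Psi>)
      show "norm ((1 / c) *\<^sub>R ?\<Psi> l x) \<le> norm x" if "l < L" for l x
        using \<Psi>_bound[OF that, of x] c by (simp add: field_simps)
    qed (use n in \<open>auto simp: V_def\<close>)
    have split: "(\<Sum>l<L. ?\<Psi> l (grid_increment L l \<omega>)) = ?S1 \<omega> + c *\<^sub>R ?S2 \<omega>" for \<omega>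
    proof -
      have "?S1 \<omega> = (\<Sum>l<L. ?\<Psi> l (grid_increment L l \<omega>) - ?\<Psi> l (V (grid_increment L l \<omega>)))"
        using \<rho> by (intro sum.cong refl)
          (simp add: linear_scale[OF bounded_linear.linear[OF V]] blinfun.diff_right blinfun.scaleR_right
            scaleR_diff_right[symmetric] del: scaleR_diff_right)
      moreover have "c *\<^sub>R ?S2 \<omega> = (\<Sum>l<L. ?\<Psi> l (V (grid_increment L l \<omega>)))"
        using c by (simp add: scaleR_sum_right)
      ultimately show ?thesis by (simp add: sum_subtractf)
    qed
    have "prob {\<omega>\<in>space M. \<epsilon> < norm (\<Sum>l<L. ?\<Psi> l (grid_increment L l \<omega>))}
       \<le> prob ({\<omega>\<in>space M. \<epsilon>1 < norm (?S1 \<omega>)} \<union> {\<omega>\<in>space M. \<epsilon>1 < norm (?S2 \<omega>)})"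
    proof (rule finite_measure_mono)
      show "{\<omega>\<in>space M. \<epsilon> < norm (\<Sum>l<L. ?\<Psi> l (grid_increment L l \<omega>))}
        \<subseteq> {\<omega>\<in>space M. \<epsilon>1 < norm (?S1 \<omega>)} \<union> {\<omega>\<in>space M. \<epsilon>1 < norm (?S2 \<omega>)}"
      proof (rule subsetI, rule ccontr)
        fix \<omega> assume w: "\<omega> \<in> {\<omega>\<in>space M. \<epsilon> < norm (\<Sum>l<L. ?\<Psi> l (grid_increment L l \<omega>))}"
          "\<omega> \<notin> {\<omega>\<in>space M. \<epsilon>1 < norm (?S1 \<omega>)} \<union> {\<omega>\<in>space M. \<epsilon>1 < norm (?S2 \<omega>)}"
        then have le: "norm (?S1 \<omega>) \<le> \<epsilon>1" "norm (?S2 \<omega>) \<le> \<epsilon>1" by auto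
        have "norm (c *\<^sub>R ?S2 \<omega>) \<le> c * \<epsilon>1" using mult_left_mono[OF le(2), of c] c by simp
        also have "\<dots> = \<epsilon> / 2" using c by (simp add: \<epsilon>1_def)
        finally have "norm (?S1 \<omega> + c *\<^sub>R ?S2 \<omega>) \<le> \<epsilon>"
          using le(1) e1_le norm_triangle_ineq[of "?S1 \<omega>" "c *\<^sub>R ?S2 \<omega>"] by linarith
        then show False using w(1) unfolding split by simp
      qed
    qed measurable
    also have "\<dots> \<le> prob {\<omega>\<in>space M. \<epsilon>1 < norm (?S1 \<omega>)} + prob {\<omega>\<in>space M. \<epsilon>1 < norm (?S2 \<omega>)}"
      by (intro measure_Un_le) measurable
    also have "\<dots> \<le> \<epsilon>" using P1 P2 e1_le by linarith
    finally show "prob {\<omega>\<in>space M. \<epsilon> < norm (\<Sum>l<L. ?\<Psi> l (grid_increment L l \<omega>))} \<le> \<epsilon>" .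
  qed
qed

end

text \<open>\<open>idx l\<close> is the block that contains l, and it is chosen before f. Blocks may
  be empty, because several partition points can round to the same grid point.\<close>

lemma sum_blocks:
  fixes q :: "nat \<Rightarrow> nat"
  assumes "\<And>i. i < N \<Longrightarrow> q i \<le> q (Suc i)" "q 0 = 0"
  shows "\<exists>idx. (\<forall>l<q N. idx l < N \<and> q (idx l) \<le> l \<and> l < q (Suc (idx l))) \<and>
    (\<forall>f :: nat \<Rightarrow> nat \<Rightarrow> 'b::comm_monoid_add. (\<Sum>i<N. \<Sum>l\<in>{q i..<q (Suc i)}. f i l) = (\<Sum>l<q N. f (idx l) l))"
  using assms(1)
proof (induction N)
  case 0
  then show ?case by (simp add: \<open>q 0 = 0\<close>)
next
  case (Suc N)
  then obtain idx where idx: "\<And>l. l < q N \<Longrightarrow> idx l < N \<and> q (idx l) \<le> l \<and> l < q (Suc (idx l))"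
    and sum: "\<And>f :: nat \<Rightarrow> nat \<Rightarrow> 'b. (\<Sum>i<N. \<Sum>l\<in>{q i..<q (Suc i)}. f i l) = (\<Sum>l<q N. f (idx l) l)"
    by fastforce
  define idx' where "idx' l = (if l < q N then idx l else N)" for l
  have le: "q N \<le> q (Suc N)" using Suc.prems by simp
  show ?case
  proof (intro exI[of _ idx'] conjI allI impI)
    fix l assume "l < q (Suc N)"
    then show "idx' l < Suc N" "q (idx' l) \<le> l" "l < q (Suc (idx' l))"
      using idx[of l] by (auto simp: idx'_def)
  next
    fix f :: "nat \<Rightarrow> nat \<Rightarrow> 'b"
    have "(\<Sum>l<q (Suc N). f (idx' l) l) = (\<Sum>l<q N. f (idx' l) l) + (\<Sum>l\<in>{q N..<q (Suc N)}. f (idx' l) l)"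
      using sum.atLeastLessThan_concat[of 0 "q N" "q (Suc N)" "\<lambda>l. f (idx' l) l"] le
      by (simp add: atLeast0LessThan)
    also have "(\<Sum>l<q N. f (idx' l) l) = (\<Sum>l<q N. f (idx l) l)"
      by (intro sum.cong) (auto simp: idx'_def)
    also have "(\<Sum>l\<in>{q N..<q (Suc N)}. f (idx' l) l) = (\<Sum>l\<in>{q N..<q (Suc N)}. f N l)"
      by (intro sum.cong) (auto simp: idx'_def)
    finally show "(\<Sum>i<Suc N. \<Sum>l\<in>{q i..<q (Suc i)}. f i l) = (\<Sum>l<q (Suc N). f (idx' l) l)"
      by (simp add: sum)
  qed
qed

lemma is_partition_mono:
  assumes "is_partition t N p" "i \<le> j" "j \<le> N"
  shows "p i \<le> p j"
  using \<open>i \<le> j\<close> \<open>j \<le> N\<close>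
proof (induction j rule: dec_induct)
  case (step j)
  then have "p j < p (Suc j)" using assms(1) by (simp add: is_partition_def)
  then show ?case using step by simp
qed simp

lemma is_partition_bounds:
  assumes "is_partition t N p" "i \<le> N"
  shows "0 \<le> p i" "p i \<le> t"
  using is_partition_mono[OF assms(1), of 0 i] is_partition_mono[OF assms(1), of i N] assms
  by (auto simp: is_partition_def)

section \<open>Comparison of Riemann sums with grid sums\<close>

context stochastic_convolution
begin

text \<open>\<open>real (grid_index L u) * (t / real L)\<close> is u rounded down to the
  grid.\<close>

definition grid_index :: "nat \<Rightarrow> real \<Rightarrow> nat" where
  "grid_index L u = nat \<lfloor>u * real L / t\<rfloor>"

lemma grid_index_bounds:
  assumes "0 \<le> u" "0 < L"
  shows "real (grid_index L u) * (t / real L) \<le> u"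
    and "u - t / real L \<le> real (grid_index L u) * (t / real L)"
proof -
  define x where "x = u * real L / t"
  have x: "x \<ge> 0" using assms t_pos by (simp add: x_def)
  have u: "u = x * (t / real L)" using assms t_pos by (simp add: x_def)
  have g: "real (grid_index L u) = of_int \<lfloor>x\<rfloor>"
    using x by (simp add: grid_index_def x_def[symmetric])
  have p: "0 \<le> t / real L" using t_pos by simp
  have "of_int \<lfloor>x\<rfloor> \<le> x" by linarith
  from mult_right_mono[OF this p] show "real (grid_index L u) * (t / real L) \<le> u"
    unfolding g using u by simp
  have "x - 1 \<le> of_int \<lfloor>x\<rfloor>" by linarith
  from mult_right_mono[OF this p] show "u - t / real L \<le> real (grid_index L u) * (t / real L)"
    unfolding g using u by (simp only: left_diff_distrib mult_1)
qed

lemma grid_index_tendsto: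
  assumes "0 \<le> u"
  shows "(\<lambda>L. real (grid_index L u) * (t / real L)) \<longlonglongrightarrow> u"
proof (rule tendsto_sandwich)
  show "eventually (\<lambda>L. u - t / real L \<le> real (grid_index L u) * (t / real L)) sequentially"
    "eventually (\<lambda>L. real (grid_index L u) * (t / real L) \<le> u) sequentially"
    using grid_index_bounds[OF assms] by (auto intro!: eventually_mono[OF eventually_gt_at_top[of 0]])
  show "(\<lambda>L. u - t / real L) \<longlonglongrightarrow> u"
    using tendsto_diff[OF tendsto_const lim_const_over_n[of t], of u] by simp
qed simp

lemma measurable_riemann_sum:
  assumes "\<And>i. i \<le> N \<Longrightarrow> p i \<le> t"
  shows "riemann_sum N p s \<in> borel_measurable M"
proof -
  have "(\<lambda>\<omega>. Z (t - p i) \<omega> - Z (t - p (Suc i)) \<omega>) \<in> borel_measurable M" if "i < N" for i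
    using assms[of i] assms[of "Suc i"] that by (intro borel_measurable_diff measurable_process) auto
  then show ?thesis
    unfolding riemann_sum_def[abs_def]
    by (intro borel_measurable_sum borel_measurable_blinfun_apply_const) auto
qed

text \<open>With N and the tags fixed, this is a finite sum of Lipschitz images of \<open>Z\<close>
  at converging times.\<close>

lemma conv_in_prob_riemann_sum:
  assumes p: "\<And>i L. i \<le> N \<Longrightarrow> p L i \<le> t" "\<And>i. i \<le> N \<Longrightarrow> p' i \<le> t"
    and lim: "\<And>i. i \<le> N \<Longrightarrow> (\<lambda>L. p L i) \<longlonglongrightarrow> p' i"
  shows "conv_in_prob M (\<lambda>L. riemann_sum N (p L) s) (riemann_sum N p' s)"
proof -
  have mZ: "Z (t - p L i) \<in> borel_measurable M" "Z (t - p' i) \<in> borel_measurable M" if "i \<le> N" for i L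
    using p that by (auto intro!: measurable_process)
  have conv: "conv_in_prob M (\<lambda>L. Z (t - p L i)) (Z (t - p' i))" if "i \<le> N" for i
    using p[OF that] lim[OF that] by (intro stochastically_continuous tendsto_intros) auto
  let ?B = "\<lambda>i x. blinfun_apply (R (s i)) x"
  have lip: "dist (?B i x) (?B i y) \<le> norm (R (s i)) * dist x y"
    "dist (?B i (- x)) (?B i (- y)) \<le> norm (R (s i)) * dist x y" for i x y
    using norm_blinfun[of "R (s i)" "x - y"] norm_blinfun[of "R (s i)" "y - x"]
    by (auto simp: dist_norm norm_minus_commute simp flip: blinfun.diff_right)
  have "conv_in_prob M (\<lambda>L \<omega>. \<Sum>i<N. ?B i (Z (t - p L i) \<omega>) + ?B i (- Z (t - p L (Suc i)) \<omega>))
      (\<lambda>\<omega>. \<Sum>i<N. ?B i (Z (t - p' i) \<omega>) + ?B i (- Z (t - p' (Suc i)) \<omega>))"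
    by (intro conv_in_prob_sum conv_in_prob_add prob_space_axioms finite_lessThan borel_measurable_add
        borel_measurable_blinfun_apply_const
        borel_measurable_uminus mZ conv_in_prob_lipschitz[OF conv lip(1)] conv_in_prob_lipschitz[OF conv lip(2)])
      auto
  then show ?thesis
    unfolding riemann_sum_def[abs_def] by (simp add: blinfun.diff_right blinfun.minus_right)
qed

text \<open>After rounding, every partition cell is a union of grid cells, and each of these
  receives the tag of its partition cell as \<open>a l\<close>. Both \<open>a l\<close> and the grid
  point of l lie between \<open>p i - t / L\<close> and \<open>p (Suc i)\<close>, hence the distance
  bound.\<close>

lemma riemann_sum_minus_grid_sum:
  assumes part: "is_partition t N p" and tags: "\<And>i. i < N \<Longrightarrow> p i \<le> s i \<and> s i \<le> p (Suc i)"
    and mesh: "\<And>i. i < N \<Longrightarrow> p (Suc i) - p i \<le> \<delta>" and "0 < L"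
  obtains a where "\<And>l. l < L \<Longrightarrow> a l \<in> {0..t} \<and> \<bar>a l - real l * (t / real L)\<bar> \<le> \<delta> + t / real L"
    "\<And>\<omega>. riemann_sum N (\<lambda>i. real (grid_index L (p i)) * (t / real L)) s \<omega> - grid_sum L \<omega>
      = (\<Sum>l<L. blinfun_apply (R (a l) - R (real l * (t / real L))) (grid_increment L l \<omega>))"
proof -
  define q where "q i = grid_index L (p i)" for i
  \<comment> \<open>The end points 0 and t are grid points, so rounding fixes them and the blocks
    exhaust the grid.\<close>
  have q0: "q 0 = 0" using part by (simp add: q_def grid_index_def is_partition_def)
  have qN: "q N = L" using part t_pos by (simp add: q_def grid_index_def is_partition_def)
  have qmono: "q i \<le> q (Suc i)" if "i < N" for i
  proof -
    have "p i * real L / t \<le> p (Suc i) * real L / t"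
      using part that t_pos by (intro divide_right_mono mult_right_mono) (auto simp: is_partition_def less_imp_le)
    then show ?thesis unfolding q_def grid_index_def by (intro nat_mono floor_mono)
  qed
  from sum_blocks[of N q, OF qmono q0] obtain idx
    where idx: "\<And>l. l < L \<Longrightarrow> idx l < N \<and> q (idx l) \<le> l \<and> l < q (Suc (idx l))"
      and sum: "\<And>f :: nat \<Rightarrow> nat \<Rightarrow> 'h. (\<Sum>i<N. \<Sum>l\<in>{q i..<q (Suc i)}. f i l) = (\<Sum>l<L. f (idx l) l)"
    unfolding qN by blast
  show thesis
  proof (rule that[of "\<lambda>l. s (idx l)"])
    fix l assume l: "l < L"
    define i where "i = idx l"
    have i: "i < N" "q i \<le> l" "l < q (Suc i)" using idx[OF l] by (auto simp: i_def)
    have pb: "0 \<le> p i" "p (Suc i) \<le> t" "0 \<le> p (Suc i)"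
      using is_partition_bounds[OF part, of i] is_partition_bounds[OF part, of "Suc i"] i by auto
    have h: "0 \<le> t / real L" using t_pos by simp
    have "real l * (t / real L) \<le> real (q (Suc i)) * (t / real L)"
      using i h by (intro mult_right_mono) auto
    then have up: "real l * (t / real L) \<le> p (Suc i)"
      using grid_index_bounds(1)[OF pb(3) \<open>0 < L\<close>] unfolding q_def by linarith
    have "real (q i) * (t / real L) \<le> real l * (t / real L)"
      using i h by (intro mult_right_mono) auto
    then have low: "p i - t / real L \<le> real l * (t / real L)"
      using grid_index_bounds(2)[OF pb(1) \<open>0 < L\<close>] unfolding q_def by linarith
    have "\<bar>s i - real l * (t / real L)\<bar> \<le> \<delta> + t / real L"
      using tags[OF i(1)] mesh[OF i(1)] up low h by linarith
    then show "s (idx l) \<in> {0..t} \<and> \<bar>s (idx l) - real l * (t / real L)\<bar> \<le> \<delta> + t / real L"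
      using tags[OF i(1)] pb unfolding i_def[symmetric] by auto
  next
    fix \<omega>
    have "riemann_sum N (\<lambda>i. real (q i) * (t / real L)) s \<omega>
      = (\<Sum>i<N. \<Sum>l\<in>{q i..<q (Suc i)}. blinfun_apply (R (s i)) (grid_increment L l \<omega>))"
      unfolding riemann_sum_def
      by (intro sum.cong refl) (simp add: sum_grid_increment qmono flip: blinfun.sum_right)
    also have "\<dots> = (\<Sum>l<L. blinfun_apply (R (s (idx l))) (grid_increment L l \<omega>))"
      by (rule sum)
    finally show "riemann_sum N (\<lambda>i. real (grid_index L (p i)) * (t / real L)) s \<omega> - grid_sum L \<omega>
      = (\<Sum>l<L. blinfun_apply (R (s (idx l)) - R (real l * (t / real L))) (grid_increment L l \<omega>))"
      by (simp add: q_def grid_sum_def blinfun.diff_left sum_subtractf)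
  qed
qed

text \<open>\<delta> is chosen before the partition, but how large \<open>L\<close> must be depends
  on the partition, since the rounding error involves its N + 1 points.\<close>

lemma riemann_sum_near_grid_sum:
  assumes "0 < \<epsilon>"
  shows "\<exists>\<delta>>0. \<forall>N p s. is_partition t N p \<longrightarrow> (\<forall>i<N. p i \<le> s i \<and> s i \<le> p (Suc i)) \<longrightarrow>
    (\<forall>i<N. p (Suc i) - p i \<le> \<delta>) \<longrightarrow>
    eventually (\<lambda>L. prob {\<omega>\<in>space M. \<epsilon> < dist (riemann_sum N p s \<omega>) (grid_sum L \<omega>)} \<le> \<epsilon>) sequentially"
proof -
  have e2: "0 < \<epsilon> / 2" using assms by simp
  obtain \<delta> where \<delta>: "\<delta> > 0" and small: "\<And>L a b. (\<And>l. l < L \<Longrightarrow> a l \<in> {0..t} \<and> b l \<in> {0..t} \<and> \<bar>a l - b l\<bar> \<le> \<delta>) \<Longrightarrow>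
    prob {\<omega>\<in>space M. \<epsilon> / 2 < norm (\<Sum>l<L. blinfun_apply (R (a l) - R (b l)) (grid_increment L l \<omega>))} \<le> \<epsilon> / 2"
    using operator_sum_small[OF e2] by blast
  show ?thesis
  \<comment> \<open>One half of \<delta> is for the mesh, the other for the grid width t /
    L.\<close>
  proof (intro exI[of _ "\<delta> / 2"] conjI allI impI)
    show "0 < \<delta> / 2" using \<delta> by simp
    fix N p s
    assume part: "is_partition t N p" and tags: "\<forall>i<N. p i \<le> s i \<and> s i \<le> p (Suc i)"
      and mesh: "\<forall>i<N. p (Suc i) - p i \<le> \<delta> / 2"
    note pb = is_partition_bounds[OF part]
    let ?p = "\<lambda>L i. real (grid_index L (p i)) * (t / real L)"
    have pL: "?p L i \<le> t" if "i \<le> N" for L i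
      using grid_index_bounds(1)[OF pb(1)[OF that], of L] pb(2)[OF that] t_pos by (cases "L = 0") auto
    have m: "riemann_sum N p s \<in> borel_measurable M" "riemann_sum N (?p L) s \<in> borel_measurable M" for L
      using pb pL by (auto intro!: measurable_riemann_sum)
    have "conv_in_prob M (\<lambda>L. riemann_sum N (?p L) s) (riemann_sum N p s)"
      using pb pL by (intro conv_in_prob_riemann_sum grid_index_tendsto) auto
    then have "(\<lambda>L. prob {\<omega>\<in>space M. \<epsilon> / 2 < dist (riemann_sum N (?p L) s \<omega>) (riemann_sum N p s \<omega>)}) \<longlonglongrightarrow> 0"
      using e2 unfolding conv_in_prob_def by blast
    then have ev1: "eventually (\<lambda>L. prob {\<omega>\<in>space M. \<epsilon> / 2 < dist (riemann_sum N (?p L) s \<omega>) (riemann_sum N p s \<omega>)} < \<epsilon> / 2) sequentially"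
      using e2 by (rule order_tendstoD(2))
    have ev2: "eventually (\<lambda>L. t / real L < \<delta> / 2) sequentially"
      using \<delta> by (intro order_tendstoD(2)[OF lim_const_over_n]) simp
    show "eventually (\<lambda>L. prob {\<omega>\<in>space M. \<epsilon> < dist (riemann_sum N p s \<omega>) (grid_sum L \<omega>)} \<le> \<epsilon>) sequentially"
      using ev1 ev2 eventually_gt_at_top[of 0]
    proof eventually_elim
      case (elim L)
      obtain a where a: "\<And>l. l < L \<Longrightarrow> a l \<in> {0..t} \<and> \<bar>a l - real l * (t / real L)\<bar> \<le> \<delta> / 2 + t / real L"
        and diff: "\<And>\<omega>. riemann_sum N (?p L) s \<omega> - grid_sum L \<omega>
          = (\<Sum>l<L. blinfun_apply (R (a l) - R (real l * (t / real L))) (grid_increment L l \<omega>))"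
        using riemann_sum_minus_grid_sum[OF part _ _ elim(3), of s "\<delta> / 2"] tags mesh by auto
      have "prob {\<omega>\<in>space M. \<epsilon> / 2 < dist (riemann_sum N (?p L) s \<omega>) (grid_sum L \<omega>)} \<le> \<epsilon> / 2"
        unfolding dist_norm diff
      proof (rule small)
        fix l assume l: "l < L"
        have "real l * (t / real L) \<in> {0..t}" using grid_point_le[of l L] l t_pos by simp
        moreover have "\<bar>a l - real l * (t / real L)\<bar> \<le> \<delta>" using a[OF l] elim(2) by linarith
        ultimately show "a l \<in> {0..t} \<and> real l * (t / real L) \<in> {0..t} \<and> \<bar>a l - real l * (t / real L)\<bar> \<le> \<delta>"
          using a[OF l] by blast
      qed
      moreover have "prob {\<omega>\<in>space M. \<epsilon> < dist (riemann_sum N p s \<omega>) (grid_sum L \<omega>)}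
        \<le> prob {\<omega>\<in>space M. \<epsilon> / 2 < dist (riemann_sum N p s \<omega>) (riemann_sum N (?p L) s \<omega>)}
          + prob {\<omega>\<in>space M. \<epsilon> / 2 < dist (riemann_sum N (?p L) s \<omega>) (grid_sum L \<omega>)}"
        using m by (intro prob_dist_triangle measurable_grid_sum) auto
      ultimately show ?case using elim(1) by (simp add: dist_commute)
    qed
  qed
qed

lemma grid_sum_eq_riemann_sum:
  "grid_sum L = riemann_sum L (\<lambda>i. real i * (t / real L)) (\<lambda>i. real i * (t / real L))"
  by (simp add: fun_eq_iff grid_sum_def riemann_sum_def grid_increment_def)

lemma is_partition_grid: "0 < L \<Longrightarrow> is_partition t L (\<lambda>i. real i * (t / real L))"
  using t_pos by (auto simp: is_partition_def intro!: divide_strict_right_mono mult_strict_right_mono)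

text \<open>The grids for m and n need not refine each other; both sums are compared with one grid
  sum for a sufficiently large common \<open>L\<close>.\<close>

lemma grid_sum_converges:
  obtains Y where "Y \<in> borel_measurable M" "conv_in_prob M grid_sum Y"
proof (rule conv_in_prob_of_Cauchy_in_prob[of grid_sum, OF measurable_grid_sum])
  fix e :: real assume "e > 0"
  then have e2: "e / 2 > 0" by simp
  obtain \<delta> where \<delta>: "\<delta> > 0" and near: "\<And>N p s. is_partition t N p \<Longrightarrow> (\<forall>i<N. p i \<le> s i \<and> s i \<le> p (Suc i)) \<Longrightarrow>
    (\<forall>i<N. p (Suc i) - p i \<le> \<delta>) \<Longrightarrow>
    eventually (\<lambda>L. prob {\<omega>\<in>space M. e / 2 < dist (riemann_sum N p s \<omega>) (grid_sum L \<omega>)} \<le> e / 2) sequentially"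
    using riemann_sum_near_grid_sum[OF e2] by blast
  have "eventually (\<lambda>L. t / real L < \<delta>) sequentially"
    using \<delta> by (intro order_tendstoD(2)[OF lim_const_over_n]) simp
  then obtain K where K: "\<And>L. L \<ge> K \<Longrightarrow> t / real L < \<delta>"
    unfolding eventually_sequentially by blast
  \<comment> \<open>\<open>Suc K\<close> also ensures m > 0, without which the grid is no
    partition.\<close>
  have ev: "eventually (\<lambda>L. prob {\<omega>\<in>space M. e / 2 < dist (grid_sum m \<omega>) (grid_sum L \<omega>)} \<le> e / 2) sequentially"
    if "m \<ge> Suc K" for m
    unfolding grid_sum_eq_riemann_sum[of m]
    using that K[of m] t_pos by (intro near is_partition_grid) (auto simp: algebra_simps add_divide_distrib)
  show "\<exists>K. \<forall>m\<ge>K. \<forall>n\<ge>K. prob {\<omega>\<in>space M. e < dist (grid_sum m \<omega>) (grid_sum n \<omega>)} \<le> e"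
  proof (intro exI[of _ "Suc K"] allI impI)
    fix m n assume "m \<ge> Suc K" "n \<ge> Suc K"
    from eventually_conj[OF ev[OF this(1)] ev[OF this(2)]] obtain L
      where L: "prob {\<omega>\<in>space M. e / 2 < dist (grid_sum m \<omega>) (grid_sum L \<omega>)} \<le> e / 2"
        "prob {\<omega>\<in>space M. e / 2 < dist (grid_sum n \<omega>) (grid_sum L \<omega>)} \<le> e / 2"
      unfolding eventually_sequentially by blast
    have "prob {\<omega>\<in>space M. e < dist (grid_sum m \<omega>) (grid_sum n \<omega>)}
      \<le> prob {\<omega>\<in>space M. e / 2 < dist (grid_sum m \<omega>) (grid_sum L \<omega>)}
        + prob {\<omega>\<in>space M. e / 2 < dist (grid_sum L \<omega>) (grid_sum n \<omega>)}"
      by (intro prob_dist_triangle measurable_grid_sum) auto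
    then show "prob {\<omega>\<in>space M. e < dist (grid_sum m \<omega>) (grid_sum n \<omega>)} \<le> e"
      using L by (simp add: dist_commute)
  qed
qed (use that in blast)

lemma riemann_sums_converge:
  assumes Y [measurable]: "Y \<in> borel_measurable M" and conv: "conv_in_prob M grid_sum Y"
    and part: "\<And>n. is_partition t (N n) (p n)" and mesh: "(\<lambda>n. mesh (N n) (p n)) \<longlonglongrightarrow> 0"
    and tags: "\<And>n i. i < N n \<Longrightarrow> p n i \<le> s n i \<and> s n i \<le> p n (Suc i)"
  shows "conv_in_prob M (\<lambda>n. riemann_sum (N n) (p n) (s n)) Y"
  unfolding conv_in_prob_def
proof (intro allI impI LIMSEQ_I)
  fix e d :: real assume "e > 0" "d > 0"
  define c where "c = min (e / 2) (d / 4)"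
  have c: "c > 0" "c + c \<le> e" "c \<le> d / 4" using \<open>e > 0\<close> \<open>d > 0\<close> by (auto simp: c_def)
  obtain \<delta> where \<delta>: "\<delta> > 0" and near: "\<And>N p s. is_partition t N p \<Longrightarrow> (\<forall>i<N. p i \<le> s i \<and> s i \<le> p (Suc i)) \<Longrightarrow>
    (\<forall>i<N. p (Suc i) - p i \<le> \<delta>) \<Longrightarrow>
    eventually (\<lambda>L. prob {\<omega>\<in>space M. c < dist (riemann_sum N p s \<omega>) (grid_sum L \<omega>)} \<le> c) sequentially"
    using riemann_sum_near_grid_sum[OF c(1)] by blast
  obtain n0 where n0: "\<And>n. n \<ge> n0 \<Longrightarrow> mesh (N n) (p n) < \<delta>"
    using order_tendstoD(2)[OF mesh \<delta>] unfolding eventually_sequentially by blast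
  have "(\<lambda>L. prob {\<omega>\<in>space M. c < dist (grid_sum L \<omega>) (Y \<omega>)}) \<longlonglongrightarrow> 0"
    using conv c(1) unfolding conv_in_prob_def by blast
  then have ev: "eventually (\<lambda>L. prob {\<omega>\<in>space M. c < dist (grid_sum L \<omega>) (Y \<omega>)} < d / 4) sequentially"
    using \<open>d > 0\<close> by (intro order_tendstoD(2)) auto
  have "norm (prob {\<omega>\<in>space M. e < dist (riemann_sum (N n) (p n) (s n) \<omega>) (Y \<omega>)} - 0) < d" if "n \<ge> n0" for n
  proof -
    have "p n (Suc i) - p n i \<le> \<delta>" if "i < N n" for i
    proof -
      have "p n (Suc i) - p n i \<le> mesh (N n) (p n)"
        unfolding mesh_def using that by (intro Max_ge) auto
      then show ?thesis using n0[OF \<open>n \<ge> n0\<close>] by simp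
    qed
    then have "eventually (\<lambda>L. prob {\<omega>\<in>space M. c < dist (riemann_sum (N n) (p n) (s n) \<omega>) (grid_sum L \<omega>)} \<le> c) sequentially"
      using tags by (intro near part) auto
    from eventually_conj[OF this ev] obtain L
      where L: "prob {\<omega>\<in>space M. c < dist (riemann_sum (N n) (p n) (s n) \<omega>) (grid_sum L \<omega>)} \<le> c"
        "prob {\<omega>\<in>space M. c < dist (grid_sum L \<omega>) (Y \<omega>)} < d / 4"
      unfolding eventually_sequentially by blast
    have "prob {\<omega>\<in>space M. e < dist (riemann_sum (N n) (p n) (s n) \<omega>) (Y \<omega>)}
      \<le> prob {\<omega>\<in>space M. c < dist (riemann_sum (N n) (p n) (s n) \<omega>) (grid_sum L \<omega>)}
        + prob {\<omega>\<in>space M. c < dist (grid_sum L \<omega>) (Y \<omega>)}"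
      using c is_partition_bounds[OF part]
      by (intro prob_dist_triangle measurable_grid_sum measurable_riemann_sum Y) auto
    then show ?thesis using L c \<open>d > 0\<close> by simp
  qed
  then show "\<exists>no. \<forall>n\<ge>no. norm (prob {\<omega>\<in>space M. e < dist (riemann_sum (N n) (p n) (s n) \<omega>) (Y \<omega>)} - 0) < d"
    by blast
qed

end

section \<open>Infinite divisibility\<close>

text \<open>Realizes the sum of n independent copies on the product space, where convergence in
  probability can be used coordinate by coordinate.\<close>

lemma distr_PiM_sum:
  fixes f :: "'a \<Rightarrow> 'h::{real_normed_vector,second_countable_topology}"
  assumes "prob_space M" and f: "f \<in> borel_measurable M"
  shows "distr (PiM {..<n::nat} (\<lambda>_. distr M borel f)) borel (\<lambda>x. \<Sum>j<n. x j)
    = distr (PiM {..<n} (\<lambda>_. M)) borel (\<lambda>\<omega>. \<Sum>j<n. f (\<omega> j))"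
proof -
  interpret prob_space M by fact
  define D where "D = distr M borel f"
  have setsD: "sets D = sets borel" by (simp add: D_def)
  have D: "prob_space D" unfolding D_def using f by (rule prob_space_distr)
  have fD: "f \<in> measurable M D" using f measurable_cong_sets[OF refl setsD] by blast
  have "distr M D f = D" unfolding D_def by (intro distr_cong) auto
  then have eq: "PiM {..<n} (\<lambda>_. D) = distr (PiM {..<n} (\<lambda>_. M)) (PiM {..<n} (\<lambda>_. D)) (compose {..<n} f)"
    using distr_PiM_finite_prob_space'[of "{..<n}" "\<lambda>_. M" "\<lambda>_. D" f] D fD prob_space_axioms by simp
  have m1: "compose {..<n} f \<in> measurable (PiM {..<n} (\<lambda>_. M)) (PiM {..<n} (\<lambda>_. D))"
    unfolding compose_def
    by (intro measurable_restrict measurable_compose[OF _ fD] measurable_component_singleton)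
  have "(\<lambda>x. x j) \<in> borel_measurable (PiM {..<n} (\<lambda>_. D))" if "j < n" for j
    using measurable_component_singleton[of j "{..<n}" "\<lambda>_. D"] that measurable_cong_sets[OF refl setsD]
    by blast
  then have m2: "(\<lambda>x. \<Sum>j<n. x j) \<in> borel_measurable (PiM {..<n} (\<lambda>_. D))"
    by (intro borel_measurable_sum) auto
  show ?thesis
    unfolding D_def[symmetric] by (subst eq, subst distr_distr[OF m2 m1]) (simp add: comp_def compose_def)
qed

lemma conv_in_prob_component:
  fixes X :: "nat \<Rightarrow> 'a \<Rightarrow> 'h::{metric_space,second_countable_topology}"
  assumes "prob_space M" and X: "conv_in_prob M X Y" and "j \<in> I"
    and [measurable]: "\<And>n. X n \<in> borel_measurable M" "Y \<in> borel_measurable M"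
  shows "conv_in_prob (PiM I (\<lambda>_. M)) (\<lambda>n \<omega>. X n (\<omega> j)) (\<lambda>\<omega>. Y (\<omega> j))"
proof -
  have c [measurable]: "(\<lambda>\<omega>. \<omega> j) \<in> measurable (PiM I (\<lambda>_. M)) M"
    using \<open>j \<in> I\<close> by (rule measurable_component_singleton)
  have "measure (PiM I (\<lambda>_. M)) {\<omega>\<in>space (PiM I (\<lambda>_. M)). e < dist (X n (\<omega> j)) (Y (\<omega> j))}
    = measure M {\<omega>\<in>space M. e < dist (X n \<omega>) (Y \<omega>)}" for e n
  proof -
    have "measure M {\<omega>\<in>space M. e < dist (X n \<omega>) (Y \<omega>)}
      = measure (distr (PiM I (\<lambda>_. M)) M (\<lambda>\<omega>. \<omega> j)) {\<omega>\<in>space M. e < dist (X n \<omega>) (Y \<omega>)}"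
      using distr_PiM_component[of I "\<lambda>_. M" j] assms by simp
    also have "\<dots> = measure (PiM I (\<lambda>_. M)) ((\<lambda>\<omega>. \<omega> j) -` {\<omega>\<in>space M. e < dist (X n \<omega>) (Y \<omega>)} \<inter> space (PiM I (\<lambda>_. M)))"
      by (rule measure_distr[OF c]) measurable
    also have "(\<lambda>\<omega>. \<omega> j) -` {\<omega>\<in>space M. e < dist (X n \<omega>) (Y \<omega>)} \<inter> space (PiM I (\<lambda>_. M))
        = {\<omega>\<in>space (PiM I (\<lambda>_. M)). e < dist (X n (\<omega> j)) (Y (\<omega> j))}"
      using measurable_space[OF c] by auto
    finally show ?thesis ..
  qed
  then show ?thesis using X by (simp add: conv_in_prob_def)
qed

lemma (in stationary_increments) time_scaled:
  assumes "0 < c"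
  shows "stationary_increments M (\<lambda>u. Z (u / c))"
proof
  show "Z (u / c) \<in> borel_measurable M" if "0 \<le> u" for u
    using that assms by (intro measurable_process) simp
  show "indep_vars (\<lambda>_. borel) (\<lambda>k \<omega>. Z (r (Suc k) / c) \<omega> - Z (r k / c) \<omega>) {..<n}"
    if "0 \<le> r 0" "\<And>k. k < n \<Longrightarrow> r k \<le> r (Suc k)" for n :: nat and r
    using that assms by (intro indep_increments[of "\<lambda>k. r k / c"]) (auto intro: divide_right_mono)
  show "distr M borel (\<lambda>\<omega>. Z ((s + h) / c) \<omega> - Z (s / c) \<omega>) = distr M borel (\<lambda>\<omega>. Z (h / c) \<omega> - Z (0 / c) \<omega>)"
    if "0 \<le> s" "0 \<le> h" for s h
    using stationary[of "s / c" "h / c"] that assms by (simp add: add_divide_distrib)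
  show "conv_in_prob M (\<lambda>k. Z (u k / c)) (Z (v / c))"
    if "\<And>k. 0 \<le> u k" "0 \<le> v" "u \<longlonglongrightarrow> v" for u v
    using that assms by (intro stochastically_continuous tendsto_divide tendsto_const) auto
qed

context stochastic_convolution
begin

lemma time_scaled_convolution:
  "0 < c \<Longrightarrow> stochastic_convolution M (\<lambda>u. Z (u / c)) R t C"
  by (intro stochastic_convolution.intro time_scaled stochastic_convolution_axioms.intro
      t_pos R_bound R_continuous)

text \<open>An increment over a grid cell is the sum of the \<open>n\<close> increments over its subcells. Collecting
  the \<open>j\<close>-th subcells of all cells writes the grid sum as a sum of \<open>n\<close> independent terms, each
  distributed like the grid sum of the process run at speed \<open>1 / n\<close>.\<close>

lemma distr_grid_sum_time_scaled:
  assumes "0 < n" "0 < L"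
  shows "distr M borel (grid_sum L) =
    distr (PiM {..<n} (\<lambda>_. distr M borel (stochastic_convolution.grid_sum (\<lambda>u. Z (u / real n)) R t L)))
      borel (\<lambda>x. \<Sum>j<n. x j)"
proof -
  interpret S: stochastic_convolution M "\<lambda>u. Z (u / real n)" R t C
    using assms by (intro time_scaled_convolution) simp
  \<comment> \<open>The width of a subcell. A grid cell of width t / L for \<open>Z (u / n)\<close>
    is an increment of \<open>Z\<close> over exactly this width.\<close>
  define h where "h = t / (real L * real n)"
  have h: "0 \<le> h" using t_pos by (simp add: h_def)
  have hn: "t / real L = real n * h" using assms by (simp add: h_def)
  define B where "B l = R (real l * (t / real L))" for l
  define T where "T j \<omega> = (\<Sum>l<L. blinfun_apply (B l) (increment h ((L - Suc l) * n + j) \<omega>))" for j \<omega>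
  have block: "increment (t / real L) k \<omega> = (\<Sum>j<n. increment h (k * n + j) \<omega>)" for k \<omega>
  proof -
    have "(\<Sum>j<n. increment h (k * n + j) \<omega>) = Z (real (k * n + n) * h) \<omega> - Z (real (k * n) * h) \<omega>"
      using sum_lessThan_telescope[of "\<lambda>j. Z (real (k * n + j) * h) \<omega>" n] by (simp add: increment_def)
    then show ?thesis unfolding increment_def hn by (simp add: algebra_simps)
  qed
  have grid: "grid_sum L = (\<lambda>\<omega>. \<Sum>j<n. T j \<omega>)"
  proof
    fix \<omega>
    have "grid_sum L \<omega> = (\<Sum>l<L. \<Sum>j<n. blinfun_apply (B l) (increment h ((L - Suc l) * n + j) \<omega>))"
      unfolding grid_sum_def B_def[symmetric]
      by (intro sum.cong refl) (simp add: grid_increment_eq block blinfun.sum_right)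
    also have "\<dots> = (\<Sum>j<n. T j \<omega>)" unfolding T_def by (rule sum.swap)
    finally show "grid_sum L \<omega> = (\<Sum>j<n. T j \<omega>)" .
  qed
  have scaled: "S.grid_sum L = (\<lambda>\<omega>. \<Sum>l<L. blinfun_apply (B l) (increment h (L - Suc l) \<omega>))"
  proof
    fix \<omega>
    have "S.increment (t / real L) k \<omega> = increment h k \<omega>" for k
      using assms unfolding S.increment_def increment_def hn by simp
    then show "S.grid_sum L \<omega> = (\<Sum>l<L. blinfun_apply (B l) (increment h (L - Suc l) \<omega>))"
      unfolding S.grid_sum_def B_def[symmetric] by (intro sum.cong refl) (simp add: S.grid_increment_eq)
  qed
  define \<Phi> where "\<Phi> x = (\<Sum>l<L. blinfun_apply (B l) (x l))" for x
  have \<Phi>: "\<Phi> \<in> borel_measurable (PiM {..<L} (\<lambda>_. borel))"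
    unfolding \<Phi>_def[abs_def]
    by (intro borel_measurable_sum borel_measurable_blinfun_apply_const measurable_component_singleton) auto
  \<comment> \<open>The joint law of increments over distinct subcells does not depend on which ones
    are taken. \<open>T j\<close> and the scaled grid sum differ only in the injective index
    map.\<close>
  have law: "distr M borel (\<lambda>\<omega>. \<Sum>l<L. blinfun_apply (B l) (increment h (f l) \<omega>))
      = distr (PiM {..<L} (\<lambda>_. distr M borel (\<lambda>\<omega>. Z h \<omega> - Z 0 \<omega>))) borel \<Phi>"
    if f: "inj_on f {..<L}" for f
  proof -
    have m: "(\<lambda>\<omega>. \<lambda>l\<in>{..<L}. increment h (f l) \<omega>) \<in> measurable M (PiM {..<L} (\<lambda>_. borel))"
      by (intro measurable_restrict measurable_increment h)
    have "distr (PiM {..<L} (\<lambda>_. distr M borel (\<lambda>\<omega>. Z h \<omega> - Z 0 \<omega>))) borel \<Phi>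
      = distr (distr M (PiM {..<L} (\<lambda>_. borel)) (\<lambda>\<omega>. \<lambda>l\<in>{..<L}. increment h (f l) \<omega>)) borel \<Phi>"
      using f \<open>0 < L\<close> by (subst distr_increments[OF h]) (auto simp: lessThan_empty_iff)
    also have "\<dots> = distr M borel (\<lambda>\<omega>. \<Sum>l<L. blinfun_apply (B l) (increment h (f l) \<omega>))"
      by (subst distr_distr[OF \<Phi> m]) (simp add: comp_def \<Phi>_def)
    finally show ?thesis ..
  qed
  have lawT: "distr M borel (T j) = distr M borel (S.grid_sum L)" for j
    unfolding T_def[abs_def] scaled using \<open>0 < n\<close> by (subst (1 2) law) (auto simp: inj_on_def)
  have mT: "T j \<in> borel_measurable M" for j
    unfolding T_def[abs_def]
    by (intro borel_measurable_sum borel_measurable_blinfun_apply_const measurable_increment h)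
  \<comment> \<open>All members of \<open>K j\<close> are congruent to j modulo n, so the index sets
    are disjoint and the \<open>T j\<close> independent.\<close>
  define K where "K j = (\<lambda>l. (L - Suc l) * n + j) ` {..<L}" for j
  have "indep_vars (\<lambda>j. PiM (K j) (\<lambda>_. borel)) (\<lambda>j \<omega>. restrict (\<lambda>i. increment h i \<omega>) (K j)) {..<n}"
  proof (rule indep_vars_restrict[OF indep_vars_increment[OF h]])
    fix j assume j: "j \<in> {..<n}"
    show "K j \<subseteq> {..<L * n}"
    proof
      fix i assume "i \<in> K j"
      then obtain l where "l < L" and i: "i = (L - Suc l) * n + j" by (auto simp: K_def)
      then have "(L - Suc l) + 1 \<le> L" by simp
      then have "((L - Suc l) + 1) * n \<le> L * n" by (rule mult_le_mono1)
      then show "i \<in> {..<L * n}" using i j by simp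
    qed
  next
    show "disjoint_family_on K {..<n}"
    proof (unfold disjoint_family_on_def, intro ballI impI)
      have mod: "i mod n = j" if "i \<in> K j" "j < n" for i j
        using that by (auto simp: K_def)
      fix j j' assume "j \<in> {..<n}" "j' \<in> {..<n}" "j \<noteq> j'"
      then show "K j \<inter> K j' = {}" using mod by (metis disjoint_iff lessThan_iff)
    qed
  qed
  then have "indep_vars (\<lambda>_. borel) (\<lambda>j \<omega>. (\<lambda>j x. \<Sum>l<L. blinfun_apply (B l) (x ((L - Suc l) * n + j))) j
      (restrict (\<lambda>i. increment h i \<omega>) (K j))) {..<n}"
    by (rule indep_vars_compose2)
      (intro borel_measurable_sum borel_measurable_blinfun_apply_const measurable_component_singleton,
        auto simp: K_def)
  then have indep: "indep_vars (\<lambda>_. borel) T {..<n}"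
    by (rule iffD1[OF indep_vars_cong, rotated 3]) (auto simp: T_def K_def fun_eq_iff)
  have joint: "distr M (PiM {..<n} (\<lambda>_. borel)) (\<lambda>\<omega>. \<lambda>j\<in>{..<n}. T j \<omega>) = PiM {..<n} (\<lambda>_. distr M borel (S.grid_sum L))"
    using indep_vars_iff_distr_eq_PiM'[where I = "{..<n}" and M' = "\<lambda>_. borel" and X = T] indep mT \<open>0 < n\<close>
    by (simp add: lawT lessThan_empty_iff)
  have m1: "(\<lambda>\<omega>. \<lambda>j\<in>{..<n}. T j \<omega>) \<in> measurable M (PiM {..<n} (\<lambda>_. borel))"
    by (intro measurable_restrict mT)
  have m2: "(\<lambda>x. \<Sum>j<n. x j) \<in> borel_measurable (PiM {..<n} (\<lambda>_. borel :: 'h measure))"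
    by measurable
  show ?thesis
    unfolding joint[symmetric] grid by (subst distr_distr[OF m2 m1]) (simp add: comp_def)
qed

text \<open>The identity in law for grid sums survives the limit because both sides converge in
  probability, each on its own space. The n-th root is the law of the limit for the slowed-down
  process.\<close>

lemma infinitely_divisible_limit:
  assumes Y: "Y \<in> borel_measurable M" and conv: "conv_in_prob M grid_sum Y"
  shows "infinitely_divisible (distr M borel Y)"
  unfolding infinitely_divisible_def
proof (intro conjI allI impI)
  show "prob_space (distr M borel Y)" using Y by (rule prob_space_distr)
  fix n :: nat assume n: "1 \<le> n"
  interpret S: stochastic_convolution M "\<lambda>u. Z (u / real n)" R t C
    using n by (intro time_scaled_convolution) simp
  obtain V where V: "V \<in> borel_measurable M" and convV: "conv_in_prob M S.grid_sum V"
    using S.grid_sum_converges .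
  let ?N = "PiM {..<n} (\<lambda>_. M)"
  have N: "prob_space ?N" by (intro prob_space_PiM prob_space_axioms)
  have comp: "(\<lambda>\<omega>. f (\<omega> j)) \<in> borel_measurable ?N" if "j < n" "f \<in> borel_measurable M" for f :: "'a \<Rightarrow> 'h" and j
    using that by (intro measurable_compose[OF measurable_component_singleton]) auto
  have "distr M borel Y = distr ?N borel (\<lambda>\<omega>. \<Sum>j<n. V (\<omega> j))"
  proof (rule distr_eq_of_conv_in_prob[OF prob_space_axioms N])
    \<comment> \<open>The shift to \<open>Suc L\<close> leaves out L = 0, where there is no
      grid.\<close>
    show "conv_in_prob M (\<lambda>L. grid_sum (Suc L)) Y" using conv by (rule conv_in_prob_Suc)
    show "conv_in_prob ?N (\<lambda>L \<omega>. \<Sum>j<n. S.grid_sum (Suc L) (\<omega> j)) (\<lambda>\<omega>. \<Sum>j<n. V (\<omega> j))"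
      by (intro conv_in_prob_sum N finite_lessThan comp V S.measurable_grid_sum
          conv_in_prob_component[OF prob_space_axioms conv_in_prob_Suc[OF convV]]) auto
    show "distr M borel (grid_sum (Suc L)) = distr ?N borel (\<lambda>\<omega>. \<Sum>j<n. S.grid_sum (Suc L) (\<omega> j))" for L
      using distr_grid_sum_time_scaled[of n "Suc L"] n
      by (simp add: distr_PiM_sum[OF prob_space_axioms S.measurable_grid_sum])
    show "(\<lambda>\<omega>. \<Sum>j<n. S.grid_sum (Suc L) (\<omega> j)) \<in> borel_measurable ?N" for L
      by (intro borel_measurable_sum comp S.measurable_grid_sum) auto
    show "(\<lambda>\<omega>. \<Sum>j<n. V (\<omega> j)) \<in> borel_measurable ?N"
      by (intro borel_measurable_sum comp V) auto
  qed (use Y in \<open>auto\<close>)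
  also have "\<dots> = distr (PiM {..<n} (\<lambda>_. distr M borel V)) borel (\<lambda>x. \<Sum>i<n. x i)"
    by (rule distr_PiM_sum[OF prob_space_axioms V, symmetric])
  finally show "\<exists>\<nu>. prob_space \<nu> \<and> sets \<nu> = sets borel \<and>
      distr M borel Y = distr (PiM {..<n} (\<lambda>_. \<nu>)) borel (\<lambda>x. \<Sum>i<n. x i)"
    using prob_space_distr[OF V] by (intro exI[of _ "distr M borel V"]) auto
qed simp

text \<open>Reversal of the summation order: the forward interval k is the backward cell
  \<open>N - Suc k\<close>.\<close>

lemma step_integral_eq_riemann_sum:
  "step_integral Z (\<lambda>k. R (s (N - Suc k))) (\<lambda>k. t - p (N - k)) N = riemann_sum N p s"
proof
  fix \<omega>
  let ?g = "\<lambda>i. blinfun_apply (R (s i)) (Z (t - p i) \<omega> - Z (t - p (Suc i)) \<omega>)"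
  have "step_integral Z (\<lambda>k. R (s (N - Suc k))) (\<lambda>k. t - p (N - k)) N \<omega> = (\<Sum>k<N. ?g (N - Suc k))"
    unfolding step_integral_def by (intro sum.cong refl) (simp add: Suc_diff_Suc)
  also have "\<dots> = riemann_sum N p s \<omega>"
    unfolding riemann_sum_def by (rule sum.nat_diff_reindex)
  finally show "step_integral Z (\<lambda>k. R (s (N - Suc k))) (\<lambda>k. t - p (N - k)) N \<omega> = riemann_sum N p s \<omega>" .
qed

end

section \<open>Application to Levy processes\<close>

lemma levy_process_stationary_increments:
  assumes "levy_process M F Z"
  shows "stationary_increments M Z"
proof -
  have prob: "prob_space M" and filt: "is_filtration M F"
    and adapted: "\<And>u. 0 \<le> u \<Longrightarrow> Z u \<in> borel_measurable (F u)"
    and indep: "\<And>(n::nat) r. 0 \<le> r 0 \<Longrightarrow> (\<And>k. k < n \<Longrightarrow> r k \<le> r (Suc k)) \<Longrightarrow>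
          prob_space.indep_vars M (\<lambda>_. borel) (\<lambda>k \<omega>. Z (r (Suc k)) \<omega> - Z (r k) \<omega>) {..<n}"
    and stat: "\<And>s h. 0 \<le> s \<Longrightarrow> 0 \<le> h \<Longrightarrow>
          distr M borel (\<lambda>\<omega>. Z (s + h) \<omega> - Z s \<omega>) = distr M borel (\<lambda>\<omega>. Z h \<omega> - Z 0 \<omega>)"
    and cont: "\<And>u e. 0 \<le> u \<Longrightarrow> 0 < e \<Longrightarrow>
          ((\<lambda>s. measure M {\<omega>\<in>space M. e < dist (Z s \<omega>) (Z u \<omega>)}) \<longlongrightarrow> 0) (at u within {0..})"
    using assms unfolding levy_process_def by blast+
  show ?thesis
  proof (intro stationary_increments.intro stationary_increments_axioms.intro prob indep stat)
    fix u :: real assume "0 \<le> u"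
    have "subalgebra M (F u)" using filt by (simp add: is_filtration_def subalgebra_def)
    then show "Z u \<in> borel_measurable M" using adapted[OF \<open>0 \<le> u\<close>] by (rule measurable_from_subalg)
  next
    fix u :: "nat \<Rightarrow> real" and v assume u: "\<And>k. 0 \<le> u k" "0 \<le> v" "u \<longlonglongrightarrow> v"
    show "conv_in_prob M (\<lambda>k. Z (u k)) (Z v)"
      unfolding conv_in_prob_def
    proof (intro allI impI)
      fix e :: real assume "0 < e"
      let ?f = "\<lambda>s. measure M {\<omega>\<in>space M. e < dist (Z s \<omega>) (Z v \<omega>)}"
      \<comment> \<open>The limit at v ignores v itself, while the sequence may hit it; the value 0
        there turns the limit into continuity.\<close>
      have fv: "?f v = 0" using \<open>0 < e\<close> by simp
      have "continuous (at v within {0..}) ?f"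
        using cont[OF u(2) \<open>0 < e\<close>] unfolding continuous_within fv .
      then have "(\<lambda>k. ?f (u k)) \<longlonglongrightarrow> ?f v"
        by (rule continuous_within_tendsto_compose') (use u in auto)
      then show "(\<lambda>k. ?f (u k)) \<longlonglongrightarrow> 0" unfolding fv .
    qed
  qed auto
qed

theorem theorem3:
  fixes D :: "('h::{real_inner,complete_space,second_countable_topology}) set"
    and A :: "'h \<Rightarrow> 'h"
    and a :: "real \<Rightarrow> real"
    and R :: "real \<Rightarrow> ('h \<Rightarrow>\<^sub>L 'h)"
    and M :: "'a measure"
    and F :: "real \<Rightarrow> 'a measure"
    and Z :: "real \<Rightarrow> 'a \<Rightarrow> 'h"
    and t :: real
  assumes "closed_dense_operator D A"
    and "loc_integrable_Rplus a"
    and "resolvent_family D A a R"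
    and "levy_process M F Z"
    and "t > 0"
  shows "\<exists>Y. Y \<in> borel_measurable M \<and>
           infinitely_divisible (distr M borel Y) \<and>
           (\<forall>(N::nat \<Rightarrow> nat) (p::nat \<Rightarrow> nat \<Rightarrow> real) (s::nat \<Rightarrow> nat \<Rightarrow> real).
              (\<forall>n. is_partition t (N n) (p n)) \<and>
              (\<lambda>n. mesh (N n) (p n)) \<longlonglongrightarrow> 0 \<and>
              (\<forall>n. \<forall>i<N n. p n i \<le> s n i \<and> s n i \<le> p n (Suc i))
              \<longrightarrow> conv_in_prob M
                    (\<lambda>n. step_integral Z
                           (\<lambda>k. R (s n (N n - Suc k)))
                           (\<lambda>k. t - p n (N n - k))
                           (N n))
                    Y)"
proof -
  obtain C where C: "\<And>u. u \<in> {0..t} \<Longrightarrow> norm (R u) \<le> C"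
    using assms(3,5) unfolding resolvent_family_def by (meson less_imp_le)
  have "continuous_on {0..} (\<lambda>u. blinfun_apply (R u) x)" for x
    using assms(3) unfolding resolvent_family_def by blast
  then have cont: "continuous_on {0..t} (\<lambda>u. blinfun_apply (R u) x)" for x
    by (rule continuous_on_subset) auto
  interpret stochastic_convolution M Z R t C
    by (intro stochastic_convolution.intro stochastic_convolution_axioms.intro
        levy_process_stationary_increments[OF assms(4)] assms(5) C cont)
  \<comment> \<open>\<open>Y\<close> comes from the grid sums, before any partition is given; hence
    one limit serves all approximating sequences.\<close>
  obtain Y where Y: "Y \<in> borel_measurable M" "conv_in_prob M grid_sum Y"
    using grid_sum_converges .
  show ?thesis
    using Y(1) infinitely_divisible_limit[OF Y] riemann_sums_converge[OF Y]
    unfolding step_integral_eq_riemann_sum by blast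
qed

end
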